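(* Let $\mathbb{F}$ be an arbitrary field with $\operatorname{char}(\mathbb{F}) \neq 2$, let $n \geq 3$, let $1 \leq k \leq n-1$, and let $T: \operatorname{Mat}_{n}(\mathbb{F}) \to \operatorname{Mat}_{n}(\mathbb{F})$ be a linear map (not assumed bijective). Then $T(\Lambda^{\leq k}) = \Lambda^{\leq k}$ if and only if there exist permutations $\sigma_1, \sigma_2 \in S_n$ and diagonal matrices $D_1, D_2 \in \operatorname{Mat}_n(\mathbb{F})$ with nonzero diagonal elements such that either $T(A) = D_1 P(\sigma_1) A P(\sigma_2) D_2$ for all $A \in \operatorname{Mat}_n(\mathbb{F})$, or $T(A) = D_1 P(\sigma_1) A^T P(\sigma_2) D_2$ for all $A \in \operatorname{Mat}_n(\mathbb{F})$.
   Context: $\operatorname{Mat}_n(\mathbb{F})$ is the space of $n\times n$ matrices over $\mathbb{F}$. The permanental rank $\operatorname{prk}(A)$ of $A$ is the size of the largest square submatrix of $A$ with nonzero permanent (it is $0$ for the zero matrix). $\Lambda^{\leq k} = \{A \in \operatorname{Mat}_n(\mathbb{F}) : \operatorname{prk}(A) \leq k\}$. For $\sigma \in S_n$, $P(\sigma) = (p_{ij})$ is the permutation matrix with $p_{ij} = 1$ if $j = \sigma^{-1}(i)$ and $p_{ij}=0$ otherwise. *)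

theory Defs
  imports "HOL-Analysis.Analysis"
begin

text \<open>
  The square submatrix of \<open>A\<close> with row set \<open>I\<close> and column set \<open>J\<close>, where \<open>card I = card J\<close>, is
  viewed as an array indexed by \<open>I \<times> J\<close>. Its permanent is the sum over all bijections from
  \<open>I\<close> to \<open>J\<close>, taken as extensional functions so that each one is counted once. The empty
  submatrix has permanent 1.
\<close>

definition subpermanent :: "'a::comm_ring_1 ^ 'n ^ 'm \<Rightarrow> 'm set \<Rightarrow> 'n set \<Rightarrow> 'a" where
  "subpermanent A I J = (\<Sum>f | f \<in> I \<rightarrow>\<^sub>E J \<and> bij_betw f I J. \<Prod>i\<in>I. A $ i $ f i)"

lemma subpermanent_UNIV:
  fixes A :: "'a::comm_ring_1 ^ 'n ^ 'n"
  shows "subpermanent A UNIV UNIV = (\<Sum>\<sigma> | \<sigma> permutes UNIV. \<Prod>i\<in>UNIV. A $ i $ \<sigma> i)"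
  unfolding subpermanent_def by (rule sum.cong) (auto simp: permutes_univ bij_iff PiE_def)

lemma subpermanent_empty [simp]: "subpermanent A {} {} = 1"
  by (simp add: subpermanent_def bij_betw_def)

text \<open>
  The empty submatrix always contributes the size 0, so the maximum is over a nonempty finite set.
\<close>

definition prk :: "'a::comm_ring_1 ^ 'n ^ 'm \<Rightarrow> nat" where
  "prk A = Max {card I | I J. card I = card J \<and> subpermanent A I J \<noteq> 0}"

lemma prk_zero: "prk (0 :: 'a::comm_ring_1 ^ 'n ^ 'm) = 0"
proof -
  have "{card I | I J. card I = card J \<and> subpermanent (0 :: 'a ^ 'n ^ 'm) I J \<noteq> 0} = {0}"
  proof (intro equalityI subsetI)
    fix c assume "c \<in> {card I | I J. card I = card J \<and> subpermanent (0 :: 'a ^ 'n ^ 'm) I J \<noteq> 0}"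
    then obtain I J where c: "c = card I" and nz: "subpermanent (0 :: 'a ^ 'n ^ 'm) I J \<noteq> 0"
      by blast
    from nz have "I = {}"
      by (auto simp: subpermanent_def power_0_left split: if_splits)
    with c show "c \<in> {0}" by simp
  next
    fix c :: nat assume "c \<in> {0}"
    then show "c \<in> {card I | I J. card I = card J \<and> subpermanent (0 :: 'a ^ 'n ^ 'm) I J \<noteq> 0}"
      by (auto intro!: exI[of _ "{}"])
  qed
  then show ?thesis by (simp add: prk_def)
qed

definition prk_le :: "nat \<Rightarrow> ('a::comm_ring_1 ^ 'n ^ 'n) set" (\<open>\<Lambda>\<^sub>\<le>\<close>) where
  "\<Lambda>\<^sub>\<le> k = {A. prk A \<le> k}"

definition perm_matrix :: "('n \<Rightarrow> 'n) \<Rightarrow> 'a::zero_neq_one ^ 'n ^ 'n" where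
  "perm_matrix \<sigma> = (\<chi> i j. if j = inv \<sigma> i then 1 else 0)"

definition diagonal_matrix :: "'a::zero ^ 'n ^ 'n \<Rightarrow> bool" where
  "diagonal_matrix D \<longleftrightarrow> (\<forall>i j. i \<noteq> j \<longrightarrow> D $ i $ j = 0)"

text \<open>
  Entrywise scaling of a matrix by a field element; the library's \<open>*s\<close> on nested vectors
  would scale by a vector, and \<open>*\<^sub>R\<close> only by a real number.
\<close>

definition mat_scale :: "'a::times \<Rightarrow> 'a ^ 'n ^ 'm \<Rightarrow> 'a ^ 'n ^ 'm" where
  "mat_scale c A = map_matrix ((*) c) A"

lemma vector_space_mat_scale:
  "vector_space (mat_scale :: 'a::field \<Rightarrow> 'a ^ 'n ^ 'm \<Rightarrow> 'a ^ 'n ^ 'm)"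
  by unfold_locales (simp_all add: mat_scale_def vec_eq_iff algebra_simps)

end

theory Submission
  imports Defs
begin

text \<open>
  A linear preserver \<open>T\<close> of \<open>\<Lambda>\<^sub>\<le> k\<close> is bijective, because \<open>\<Lambda>\<^sub>\<le> k\<close> contains all matrix units. Let \<open>V\<close> be
  a subspace of \<open>\<Lambda>\<^sub>\<le> k\<close> of dimension \<open>n k\<close>, such as the image of the matrices supported on \<open>k\<close> given
  rows. The set \<open>L\<close> of lexicographically leading positions of members of \<open>V\<close> has at least \<open>n k\<close>
  elements, but contains no \<open>k + 1\<close> positions in distinct rows and columns: these would yield a
  nonzero permanent of a triangular array. Averaging over all permutations, every permutation meets
  \<open>L\<close> in exactly \<open>k\<close> positions, so \<open>L\<close> consists of \<open>k\<close> full rows or \<open>k\<close> full columns. Hence \<open>V\<close> is a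
  graph over \<open>k\<close> rows or columns, and evaluating permanents of sparse members of \<open>V\<close> shows, using
  characteristic not 2 and \<open>n \<ge> 3\<close>, that the graph is that of the zero map.

  So \<open>T\<close> maps \<open>k\<close>-row and \<open>k\<close>-column spaces to coordinate subspaces, and by intersecting them it maps
  matrix units to multiples of matrix units. The induced permutation of positions preserves
  non-collinearity, since two positions are in distinct rows and columns iff they lie in a partial
  matching of size \<open>k + 1\<close>. It is therefore given by permutations of the rows and columns, possibly
  after a transposition. The scalars form a matrix of rank one, as seen on the block
  \<open>((1, 1), (1, -1))\<close> extended by an identity matrix of size \<open>k - 1\<close>.
\<close>

section \<open>Permanents of submatrices\<close>

lemma finite_ext_bijections:
  fixes I :: "'m::finite set" and J :: "'n::finite set"
  shows "finite {f. f \<in> I \<rightarrow>\<^sub>E J \<and> bij_betw f I J}"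
  by (rule finite_subset[OF _ finite_PiE[of I "\<lambda>_. J"]]) auto

lemma subpermanent_cong:
  assumes "\<And>i j. i \<in> I \<Longrightarrow> j \<in> J \<Longrightarrow> A $ i $ j = B $ i $ j"
  shows "subpermanent A I J = subpermanent B I J"
  unfolding subpermanent_def
  by (rule sum.cong[OF refl], rule prod.cong[OF refl]) (auto simp: assms PiE_iff)

lemma subpermanent_nonzeroE:
  assumes "subpermanent A I J \<noteq> 0"
  obtains f where "bij_betw f I J" "\<And>i. i \<in> I \<Longrightarrow> A $ i $ f i \<noteq> 0"
proof -
  obtain f where "bij_betw f I J" "(\<Prod>i\<in>I. A $ i $ f i) \<noteq> 0"
    using assms unfolding subpermanent_def by (auto elim: sum.not_neutral_contains_not_neutral)
  moreover from this have "A $ i $ f i \<noteq> 0" if "i \<in> I" for i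
    using that by (metis (mono_tags, lifting) finite prod_zero)
  ultimately show thesis using that by blast
qed

text \<open>Every summand of the permanent has exactly one factor from row \<open>r\<close>, so the
  permanent is additive in that row.\<close>

lemma subpermanent_add_row:
  fixes A B C :: "'a::comm_ring_1 ^ 'n ^ 'm"
  assumes "r \<in> I"
    and "\<And>i j. i \<in> I - {r} \<Longrightarrow> A $ i $ j = B $ i $ j"
    and "\<And>i j. i \<in> I - {r} \<Longrightarrow> C $ i $ j = B $ i $ j"
    and "\<And>j. C $ r $ j = A $ r $ j + B $ r $ j"
  shows "subpermanent C I J = subpermanent A I J + subpermanent B I J"
  unfolding subpermanent_def sum.distrib[symmetric]
proof (rule sum.cong[OF refl])
  fix f :: "'m \<Rightarrow> 'n"
  have "(\<Prod>i\<in>I. M $ i $ f i) = M $ r $ f r * (\<Prod>i\<in>I-{r}. M $ i $ f i)" for M :: "'a ^ 'n ^ 'm"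
    using assms(1) by (simp add: prod.remove)
  moreover have "(\<Prod>i\<in>I-{r}. A $ i $ f i) = (\<Prod>i\<in>I-{r}. B $ i $ f i)"
    "(\<Prod>i\<in>I-{r}. C $ i $ f i) = (\<Prod>i\<in>I-{r}. B $ i $ f i)"
    using assms(2,3) by (auto intro!: prod.cong)
  ultimately show "(\<Prod>i\<in>I. C $ i $ f i) = (\<Prod>i\<in>I. A $ i $ f i) + (\<Prod>i\<in>I. B $ i $ f i)"
    by (simp add: assms(4) distrib_right)
qed

text \<open>Laplace expansion along row \<open>r\<close>: a bijection sending \<open>r\<close> into
  \<open>J\<close> contributes 0, and those sending \<open>r\<close> to \<open>c\<close> restrict to
  the bijections from \<open>I\<close> to \<open>J\<close>.\<close>

lemma subpermanent_insert:
  assumes "r \<notin> I" "c \<notin> J" and z: "\<And>j. j \<in> J \<Longrightarrow> A $ r $ j = 0"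
  shows "subpermanent A (insert r I) (insert c J) = A $ r $ c * subpermanent A I J"
proof -
  let ?F = "{f. f \<in> insert r I \<rightarrow>\<^sub>E insert c J \<and> bij_betw f (insert r I) (insert c J)}"
  let ?G = "{f. f \<in> I \<rightarrow>\<^sub>E J \<and> bij_betw f I J}"
  have "subpermanent A (insert r I) (insert c J) =
      (\<Sum>f \<in> {f\<in>?F. f r = c}. \<Prod>i\<in>insert r I. A $ i $ f i)"
    unfolding subpermanent_def
  proof (rule sum.mono_neutral_right)
    show "\<forall>f\<in>?F - {f\<in>?F. f r = c}. (\<Prod>i\<in>insert r I. A $ i $ f i) = 0"
      using assms by auto
  qed (auto intro: finite_ext_bijections)
  also have "\<dots> = (\<Sum>f\<in>?G. A $ r $ c * (\<Prod>i\<in>I. A $ i $ f i))"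
  proof (rule sum.reindex_bij_witness[where i = "\<lambda>g. g(r := c)" and j = "\<lambda>f. restrict f I"])
    fix f assume f: "f \<in> {f\<in>?F. f r = c}"
    then have fr: "f r = c" and ext: "f \<in> extensional (insert r I)"
      and b: "bij_betw f (insert r I) (insert c J)" by (auto simp: PiE_iff)
    show "(restrict f I)(r := c) = f"
      using ext fr by (auto simp: fun_eq_iff extensional_def)
    have "bij_betw f I J"
      using notIn_Un_bij_betw3[of r I f J] b assms(1,2) fr by simp
    then show "restrict f I \<in> ?G"
      by (auto simp: bij_betw_def inj_on_restrict_eq)
    show "A $ r $ c * (\<Prod>i\<in>I. A $ i $ restrict f I i) = (\<Prod>i\<in>insert r I. A $ i $ f i)"
      using assms(1) fr by simp
  next
    fix g assume g: "g \<in> ?G"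
    then show "restrict (g(r := c)) I = g"
      using assms(1) by (auto simp: fun_eq_iff PiE_iff extensional_def)
    have "bij_betw (g(r := c)) I J"
      using g assms(1) by (auto simp: bij_betw_def inj_on_def)
    then have "bij_betw (g(r := c)) (insert r I) (insert c J)"
      using assms(1,2) notIn_Un_bij_betw[of r I "g(r := c)" J] by simp
    then show "g(r := c) \<in> {f\<in>?F. f r = c}"
      using g by (auto simp: PiE_iff extensional_def)
  qed
  also have "\<dots> = A $ r $ c * subpermanent A I J"
    by (simp add: subpermanent_def sum_distrib_left)
  finally show ?thesis .
qed

text \<open>Expansion along the rows of \<open>I\<close> one at a time. It serves to pad a small
  array to size \<open>k + 1\<close> with a monomial block.\<close>

lemma subpermanent_monomial_rows:
  assumes "inj_on s I" "I \<inter> R = {}" "s ` I \<inter> C = {}"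
    and "\<And>i j. i \<in> I \<Longrightarrow> j \<in> s ` I \<union> C \<Longrightarrow> j \<noteq> s i \<Longrightarrow> A $ i $ j = 0"
  shows "subpermanent A (I \<union> R) (s ` I \<union> C) = (\<Prod>i\<in>I. A $ i $ s i) * subpermanent A R C"
proof -
  have "finite I" by simp
  then show ?thesis using assms
  proof (induction I rule: finite_induct)
    case (insert x I)
    have "subpermanent A (insert x (I \<union> R)) (insert (s x) (s ` I \<union> C)) =
        A $ x $ s x * subpermanent A (I \<union> R) (s ` I \<union> C)"
    proof (rule subpermanent_insert)
      show "A $ x $ j = 0" if "j \<in> s ` I \<union> C" for j
        using that insert.hyps insert.prems by (intro insert.prems(4)) auto
    qed (use insert.hyps insert.prems in auto)
    moreover have "subpermanent A (I \<union> R) (s ` I \<union> C) = (\<Prod>i\<in>I. A $ i $ s i) * subpermanent A R C"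
      using insert.hyps insert.prems by (intro insert.IH) auto
    ultimately show ?case using insert.hyps by (simp add: mult.assoc)
  qed simp
qed

lemma subpermanent_singleton: "subpermanent A {r} {c} = A $ r $ c"
  using subpermanent_insert[of r "{}" c "{}" A] by simp

lemma subpermanent_doubleton:
  fixes A :: "'a::comm_ring_1 ^ 'n ^ 'm"
  assumes "r \<noteq> r'" "c \<noteq> c'"
  shows "subpermanent A {r, r'} {c, c'} = A $ r $ c * A $ r' $ c' + A $ r $ c' * A $ r' $ c"
proof -
  \<comment> \<open>On the columns \<open>c\<close> and \<open>c'\<close>, row \<open>r\<close> is
    split into its two entries, so that each half can be expanded along that row.\<close>
  define A1 where "A1 = (\<chi> i j. if i = r \<and> j = c' then 0 else A $ i $ j)"
  define A2 where "A2 = (\<chi> i j. if i = r \<and> j \<noteq> c' then 0 else A $ i $ j)"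
  have "subpermanent A {r, r'} {c, c'} = subpermanent A1 {r, r'} {c, c'} + subpermanent A2 {r, r'} {c, c'}"
    using assms by (intro subpermanent_add_row[where r = r]) (auto simp: A1_def A2_def)
  also have "subpermanent A1 {r, r'} {c, c'} = A $ r $ c * A $ r' $ c'"
    using assms by (subst subpermanent_insert) (auto simp: A1_def subpermanent_singleton)
  also have "subpermanent A2 {r, r'} {c', c} = A $ r $ c' * A $ r' $ c"
    using assms by (subst subpermanent_insert) (auto simp: A2_def subpermanent_singleton)
  then have "subpermanent A2 {r, r'} {c, c'} = A $ r $ c' * A $ r' $ c"
    by (simp add: insert_commute)
  finally show ?thesis .
qed

text \<open>Inverting bijections matches the two sums; the inverses are restricted so as to stay
  extensional.\<close>

lemma subpermanent_transpose: "subpermanent (transpose A) I J = subpermanent A J I"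
  unfolding subpermanent_def
proof (rule sum.reindex_bij_witness[where i = "\<lambda>g. restrict (inv_into J g) I"
      and j = "\<lambda>f. restrict (inv_into I f) J"], goal_cases)
  case (1 f)
  then have b: "bij_betw f I J" and e: "f \<in> extensional I" by (auto simp: PiE_iff)
  have "inv_into J (restrict (inv_into I f) J) i = f i" if "i \<in> I" for i
    using b that by (intro inv_into_f_eq)
      (auto simp: bij_betw_def inj_on_restrict_eq inj_on_inv_into)
  then show ?case using e by (auto simp: fun_eq_iff extensional_def)
next
  case (2 f)
  then have "bij_betw (inv_into I f) J I" by (auto intro: bij_betw_inv_into)
  then show ?case by (auto simp: bij_betw_def inj_on_restrict_eq)
next
  case (3 f)
  then have b: "bij_betw f J I" and e: "f \<in> extensional J" by (auto simp: PiE_iff)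
  have "inv_into I (restrict (inv_into J f) I) i = f i" if "i \<in> J" for i
    using b that by (intro inv_into_f_eq)
      (auto simp: bij_betw_def inj_on_restrict_eq inj_on_inv_into)
  then show ?case using e by (auto simp: fun_eq_iff extensional_def)
next
  case (4 f)
  then have "bij_betw (inv_into J f) I J" by (auto intro: bij_betw_inv_into)
  then show ?case by (auto simp: bij_betw_def inj_on_restrict_eq)
next
  case (5 f)
  then have b: "bij_betw f I J" by simp
  show ?case
    by (subst prod.reindex_bij_betw[OF b, symmetric])
      (use b in \<open>auto simp: transpose_def bij_betw_def intro!: prod.cong\<close>)
qed

text \<open>A bijection \<open>g\<close> with nonzero product satisfies
  \<open>f (s i) \<le> f (g i)\<close> for all \<open>i\<close>. Both sides have the same sum over
  \<open>I\<close>, so equality holds throughout and only the term of \<open>s\<close>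
  survives.\<close>

lemma subpermanent_triangular:
  fixes A :: "'a::field ^ 'n ^ 'm" and f :: "'n \<Rightarrow> nat"
  assumes "inj f" "inj_on s I"
    and z: "\<And>i j. i \<in> I \<Longrightarrow> f j < f (s i) \<Longrightarrow> A $ i $ j = 0"
    and nz: "\<And>i. i \<in> I \<Longrightarrow> A $ i $ s i \<noteq> 0"
  shows "subpermanent A I (s ` I) \<noteq> 0"
proof -
  have uniq: "g = restrict s I" if g: "g \<in> I \<rightarrow>\<^sub>E s ` I" "bij_betw g I (s ` I)"
    and le: "\<And>i. i \<in> I \<Longrightarrow> f (s i) \<le> f (g i)" for g
  proof -
    have "(\<Sum>i\<in>I. f (g i)) = sum f (s ` I)"
      using g by (simp add: sum.reindex_bij_betw)
    also have "\<dots> = (\<Sum>i\<in>I. f (s i))"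
      using assms(2) by (simp add: sum.reindex)
    finally have "f (g i) = f (s i)" if "i \<in> I" for i
      using that le sum_strict_mono_ex1[of I "\<lambda>i. f (s i)" "\<lambda>i. f (g i)"]
      by (metis finite le_neq_implies_less less_irrefl)
    then have "g i = s i" if "i \<in> I" for i
      using that assms(1) by (simp add: inj_eq)
    then show ?thesis using g by (auto simp: fun_eq_iff PiE_iff extensional_def)
  qed
  have "(\<Prod>i\<in>I. A $ i $ g i) = 0"
    if "g \<in> {g. g \<in> I \<rightarrow>\<^sub>E s ` I \<and> bij_betw g I (s ` I)} - {restrict s I}" for g
  proof -
    have "\<exists>i\<in>I. f (g i) < f (s i)"
      using that uniq[of g] by (auto simp: not_le[symmetric])
    then show ?thesis using z by auto
  qed
  then have "subpermanent A I (s ` I) = (\<Sum>g\<in>{restrict s I}. \<Prod>i\<in>I. A $ i $ g i)"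
    unfolding subpermanent_def using assms(2)
    by (intro sum.mono_neutral_right finite_ext_bijections)
      (auto simp: bij_betw_def inj_on_restrict_eq)
  then show ?thesis using nz by simp
qed

section \<open>Permanental rank\<close>

lemma prk_le_iff:
  fixes A :: "'a::comm_ring_1 ^ 'n ^ 'm"
  shows "prk A \<le> k \<longleftrightarrow> (\<forall>I J. card I = card J \<longrightarrow> subpermanent A I J \<noteq> 0 \<longrightarrow> card I \<le> k)"
proof -
  let ?S = "{card I | I J. card I = card J \<and> subpermanent A I J \<noteq> 0}"
  have "?S \<subseteq> {..CARD('m)}" by (auto intro: card_mono)
  then have "finite ?S" by (rule finite_subset) simp
  moreover have "0 \<in> ?S" by (auto intro!: exI[of _ "{}"])
  ultimately have "prk A \<le> k \<longleftrightarrow> (\<forall>c\<in>?S. c \<le> k)"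
    unfolding prk_def by (subst Max_le_iff) blast+
  then show ?thesis by blast
qed

lemma prk_geI: "card I = card J \<Longrightarrow> subpermanent A I J \<noteq> 0 \<Longrightarrow> card I \<le> prk A"
  using prk_le_iff[of A "prk A"] by auto

lemma subpermanent_eq_0:
  assumes "A \<in> \<Lambda>\<^sub>\<le> k" "card I = card J" "k < card I"
  shows "subpermanent A I J = 0"
  using prk_geI[OF assms(2), of A] assms(1,3) by (force simp: prk_le_def)

lemma prk_transpose [simp]: "prk (transpose A) = prk A"
proof (rule order_antisym)
  show "prk (transpose A) \<le> prk A"
    by (subst prk_le_iff) (metis prk_geI subpermanent_transpose)
  show "prk A \<le> prk (transpose A)"
    by (subst prk_le_iff) (metis prk_geI subpermanent_transpose)
qed

lemma transpose_in_prk_le_iff [simp]: "transpose A \<in> \<Lambda>\<^sub>\<le> k \<longleftrightarrow> A \<in> \<Lambda>\<^sub>\<le> k"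
  by (simp add: prk_le_def)

lemma prk_le_supported_rows:
  assumes "\<And>i j. i \<notin> I \<Longrightarrow> A $ i $ j = 0"
  shows "prk A \<le> card I"
  unfolding prk_le_iff
proof (intro allI impI)
  fix R C assume "subpermanent A R C \<noteq> 0"
  then have "R \<subseteq> I" using assms by (metis subpermanent_nonzeroE subsetI)
  then show "card R \<le> card I" by (simp add: card_mono)
qed

section \<open>Coordinate subspaces\<close>

definition mat_unit :: "'n \<times> 'n \<Rightarrow> 'a::zero_neq_one ^ 'n ^ 'n" where
  "mat_unit p = (\<chi> i j. if (i, j) = p then 1 else 0)"

definition coord_space :: "('n \<times> 'n) set \<Rightarrow> ('a::zero ^ 'n ^ 'n) set" where
  "coord_space S = {A. \<forall>i j. (i, j) \<notin> S \<longrightarrow> A $ i $ j = 0}"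

lemma mat_unit_nth [simp]: "mat_unit p $ i $ j = (if (i, j) = p then 1 else 0)"
  by (simp add: mat_unit_def)

lemma mat_scale_nth [simp]: "mat_scale c A $ i $ j = c * A $ i $ j"
  by (simp add: mat_scale_def)

lemma sum_mat_nth: "(\<Sum>x\<in>S. f x) $ i $ j = (\<Sum>x\<in>S. f x $ i $ j)"
  by (simp add: sum_component)

lemma inj_mat_unit: "inj mat_unit"
proof (rule injI)
  fix p q :: "'a \<times> 'a" assume "(mat_unit p :: 'b ^ 'a ^ 'a) = mat_unit q"
  then have "(mat_unit p :: 'b ^ 'a ^ 'a) $ fst p $ snd p = mat_unit q $ fst p $ snd p" by simp
  then show "p = q" by (simp split: if_splits)
qed

lemma mat_expand:
  fixes A :: "'a::field ^ 'n ^ 'n"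
  assumes "A \<in> coord_space S"
  shows "A = (\<Sum>p\<in>S. mat_scale (A $ fst p $ snd p) (mat_unit p))"
proof -
  have "(\<Sum>p\<in>S. A $ fst p $ snd p * (if (i, j) = p then 1 else 0)) = A $ i $ j" for i j
  proof -
    have "(\<Sum>p\<in>S. A $ fst p $ snd p * (if (i, j) = p then 1 else 0)) =
        (\<Sum>p\<in>S. if (i, j) = p then A $ i $ j else 0)"
      by (rule sum.cong) auto
    also have "\<dots> = A $ i $ j"
      using assms by (simp add: coord_space_def)
    finally show ?thesis .
  qed
  then show ?thesis by (simp add: vec_eq_iff sum_mat_nth)
qed

interpretation mat: vector_space "mat_scale :: 'a::field \<Rightarrow> 'a ^ 'n ^ 'n \<Rightarrow> 'a ^ 'n ^ 'n"
  by (rule vector_space_mat_scale)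

lemma subspace_coord_space: "mat.subspace (coord_space S)"
  by (auto simp: mat.subspace_def coord_space_def)

lemma coord_space_eq_span: "(coord_space S :: ('a::field ^ 'n ^ 'n) set) = mat.span (mat_unit ` S)"
proof
  show "mat.span (mat_unit ` S) \<subseteq> (coord_space S :: ('a ^ 'n ^ 'n) set)"
    by (rule mat.span_minimal[OF _ subspace_coord_space]) (auto simp: coord_space_def)
  show "(coord_space S :: ('a ^ 'n ^ 'n) set) \<subseteq> mat.span (mat_unit ` S)"
  proof
    fix A :: "'a ^ 'n ^ 'n" assume "A \<in> coord_space S"
    then show "A \<in> mat.span (mat_unit ` S)"
      by (subst mat_expand) (auto intro!: mat.span_sum mat.span_scale intro: mat.span_base)
  qed
qed

lemma independent_mat_units: "mat.independent (mat_unit ` S :: ('a::field ^ 'n ^ 'n) set)"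
proof -
  have "(mat_unit p :: 'a ^ 'n ^ 'n) \<notin> mat.span (mat_unit ` S - {mat_unit p})" for p
  proof -
    have "mat_unit ` S - {mat_unit p :: 'a ^ 'n ^ 'n} = mat_unit ` (S - {p})"
      using inj_mat_unit by (auto dest: injD)
    then show ?thesis
      by (cases p) (simp add: coord_space_eq_span[symmetric] coord_space_def)
  qed
  then show ?thesis unfolding mat.dependent_def by auto
qed

lemma dim_coord_space: "mat.dim (coord_space S) = card S"
  by (simp add: coord_space_eq_span mat.dim_eq_card_independent[OF independent_mat_units]
      card_image inj_on_subset[OF inj_mat_unit])

lemma coord_space_UNIV: "coord_space UNIV = UNIV"
  by (simp add: coord_space_def)

interpretation mat: finite_dimensional_vector_space
  "mat_scale :: 'a::field \<Rightarrow> 'a ^ 'n ^ 'n \<Rightarrow> 'a ^ 'n ^ 'n" "range mat_unit"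
  by unfold_locales
    (auto simp: independent_mat_units coord_space_eq_span[symmetric] coord_space_UNIV)

interpretation mat: finite_dimensional_vector_space_pair_1
  "mat_scale :: 'a::field \<Rightarrow> 'a ^ 'n ^ 'n \<Rightarrow> 'a ^ 'n ^ 'n" "range mat_unit"
  "mat_scale :: 'a::field \<Rightarrow> 'a ^ 'n ^ 'n \<Rightarrow> 'a ^ 'n ^ 'n"
  by unfold_locales

text \<open>The coordinate projection onto \<open>coord_space S\<close>.\<close>

definition mat_mask :: "('n \<times> 'n) set \<Rightarrow> 'a::zero ^ 'n ^ 'n \<Rightarrow> 'a ^ 'n ^ 'n" where
  "mat_mask S A = (\<chi> i j. if (i, j) \<in> S then A $ i $ j else 0)"

lemma mat_mask_nth [simp]: "mat_mask S A $ i $ j = (if (i, j) \<in> S then A $ i $ j else 0)"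
  by (simp add: mat_mask_def)

lemma linear_matI:
  assumes "\<And>A B. f (A + B) = f A + f B" "\<And>c A. f (mat_scale c A) = mat_scale c (f A)"
  shows "Vector_Spaces.linear (mat_scale :: 'a::field \<Rightarrow> 'a ^ 'n ^ 'n \<Rightarrow> _)
     (mat_scale :: 'a \<Rightarrow> 'a ^ 'n ^ 'n \<Rightarrow> _) f"
  using assms by unfold_locales

lemma linear_mat_mask: "Vector_Spaces.linear (mat_scale :: 'a::field \<Rightarrow> _) mat_scale (mat_mask S)"
  by (rule linear_matI) (auto simp: vec_eq_iff)

lemma linear_transpose: "Vector_Spaces.linear (mat_scale :: 'a::field \<Rightarrow> 'a ^ 'n ^ 'n \<Rightarrow> _) mat_scale transpose"
  by (rule linear_matI) (auto simp: vec_eq_iff transpose_def)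

lemma dim_linear_image:
  fixes f :: "'a::field ^ 'n ^ 'n \<Rightarrow> 'a ^ 'n ^ 'n"
  assumes "Vector_Spaces.linear mat_scale mat_scale f" "mat.subspace V" "inj_on f V"
  shows "mat.dim (f ` V) = mat.dim V"
  using assms(1,3) by (intro mat.dim_image_eq) (simp_all only: mat.span_eq_iff[THEN iffD2, OF assms(2)])

lemma inj_on_mat_mask:
  assumes "mat.subspace V" "\<And>A. A \<in> V \<Longrightarrow> mat_mask S A = 0 \<Longrightarrow> A = 0"
  shows "inj_on (mat_mask S) V"
  using assms(2) mat.subspace_0[OF assms(1)] mat.subspace_diff[OF assms(1)]
  by (intro inj_onI) (metis eq_iff_diff_eq_0 module_hom.diff linear_mat_mask Vector_Spaces.linear_iff_module_hom)

lemma mat_mask_in_coord_space: "mat_mask S A \<in> coord_space S"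
  by (auto simp: coord_space_def)

section \<open>Leading positions\<close>

text \<open>The numbering \<open>f\<close>, later taken injective, orders both row and column
  indices; this is the first nonzero position when reading row by row.\<close>

definition leading :: "('n \<Rightarrow> nat) \<Rightarrow> 'a::zero ^ 'n ^ 'n \<Rightarrow> 'n \<times> 'n \<Rightarrow> bool" where
  "leading f A = (\<lambda>(i, j). A $ i $ j \<noteq> 0 \<and>
     (\<forall>i' j'. f i' < f i \<or> i' = i \<and> f j' < f j \<longrightarrow> A $ i' $ j' = 0))"

definition leading_set :: "('n \<Rightarrow> nat) \<Rightarrow> ('a::zero ^ 'n ^ 'n) set \<Rightarrow> ('n \<times> 'n) set" where
  "leading_set f V = {p. \<exists>A\<in>V. leading f A p}"

lemma leading_exists:
  assumes "A \<noteq> 0"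
  shows "\<exists>p. leading f A p"
proof -
  obtain i0 j0 where "A $ i0 $ j0 \<noteq> 0" using assms by (auto simp: vec_eq_iff)
  then obtain i where i: "\<exists>j. A $ i $ j \<noteq> 0" "\<And>i'. \<exists>j. A $ i' $ j \<noteq> 0 \<Longrightarrow> f i \<le> f i'"
    using ex_has_least_nat[of "\<lambda>i. \<exists>j. A $ i $ j \<noteq> 0" i0 f] by blast
  then obtain j where j: "A $ i $ j \<noteq> 0" "\<And>j'. A $ i $ j' \<noteq> 0 \<Longrightarrow> f j \<le> f j'"
    using ex_has_least_nat[of "\<lambda>j. A $ i $ j \<noteq> 0" _ f] by blast
  have "leading f A (i, j)"
    using i(2) j by (auto simp: leading_def not_le[symmetric])
  then show ?thesis ..
qed

text \<open>Masking to \<open>S\<close> keeps the entry at the leading position, so it cannot kill a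
  nonzero member of \<open>V\<close>. A subspace \<open>V\<close> thus embeds into
  \<open>coord_space S\<close>.\<close>

lemma mat_mask_leading_set:
  assumes "A \<in> V" "leading_set f V \<subseteq> S" "mat_mask S A = 0"
  shows "A = 0"
proof (rule ccontr)
  assume "A \<noteq> 0"
  then obtain i j where ij: "leading f A (i, j)" using leading_exists[of A f] by auto
  then have "(i, j) \<in> S" using assms(1,2) by (auto simp: leading_set_def)
  then have "mat_mask S A $ i $ j = A $ i $ j" by simp
  with ij assms(3) show False by (simp add: leading_def)
qed

lemma dim_le_card_leading_set:
  fixes V :: "('a::field ^ 'n ^ 'n) set"
  assumes "mat.subspace V"
  shows "mat.dim V \<le> card (leading_set f V)"
proof -
  let ?L = "leading_set f V"
  have "inj_on (mat_mask ?L) V"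
    using assms by (intro inj_on_mat_mask) (auto intro: mat_mask_leading_set)
  then have "mat.dim V = mat.dim (mat_mask ?L ` V)"
    using assms by (simp add: dim_linear_image linear_mat_mask)
  also have "\<dots> \<le> mat.dim (coord_space ?L :: ('a ^ 'n ^ 'n) set)"
    by (rule mat.dim_subset) (auto simp: mat_mask_in_coord_space)
  finally show ?thesis by (simp add: dim_coord_space)
qed

text \<open>
  Replacing, from the bottom up, row \<open>i\<close> of a matrix in \<open>V\<close> by row \<open>i\<close> of the matrix with leading
  position \<open>(i, s i)\<close> keeps all these permanents zero if they vanish on \<open>V\<close>, because the latter matrix
  vanishes above row \<open>i\<close>. The final array is triangular.
\<close>

lemma nonzero_subpermanent_from_leading_matching:
  fixes V :: "('a::field ^ 'n ^ 'n) set" and f :: "'n \<Rightarrow> nat"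
  assumes V: "mat.subspace V" and f: "inj f" and s: "inj_on s I"
    and lead: "\<And>i. i \<in> I \<Longrightarrow> (i, s i) \<in> leading_set f V"
  shows "\<exists>B\<in>V. subpermanent B I (s ` I) \<noteq> 0"
proof (rule ccontr)
  assume "\<not> ?thesis"
  then have zero: "subpermanent B I (s ` I) = 0" if "B \<in> V" for B using that by blast
  have "\<forall>i\<in>I. \<exists>A\<in>V. leading f A (i, s i)" using lead by (auto simp: leading_set_def)
  then obtain A where A: "\<And>i. i \<in> I \<Longrightarrow> A i \<in> V" "\<And>i. i \<in> I \<Longrightarrow> leading f (A i) (i, s i)"
    by metis
  define M where "M m B = (\<chi> i j. if m \<le> f i then A i $ i $ j else B $ i $ j)" for m and B :: "'a ^ 'n ^ 'n"
  \<comment> \<open>A threshold above all rows, where \<open>M N B = B\<close>. The induction on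
    \<open>d\<close> lowers it to 0, where truncated subtraction keeps it.\<close>
  define N where "N = Suc (Max (range f))"
  have N: "f i < N" for i by (simp add: N_def le_imp_less_Suc)
  have "\<forall>B\<in>V. subpermanent (M (N - d) B) I (s ` I) = 0" for d
  proof (induction d)
    case 0
    have "M N B = B" for B using N by (simp add: M_def vec_eq_iff not_le[symmetric])
    then show ?case using zero by simp
  next
    case (Suc d)
    define m where "m = N - Suc d"
    show ?case unfolding m_def[symmetric]
    proof (cases "N \<le> d")
      case True
      then show "\<forall>B\<in>V. subpermanent (M m B) I (s ` I) = 0" using Suc by (simp add: m_def)
    next
      case False
      then have IH: "subpermanent (M (Suc m) B) I (s ` I) = 0" if "B \<in> V" for B
        using that Suc by (simp add: m_def Suc_diff_Suc)
      show "\<forall>B\<in>V. subpermanent (M m B) I (s ` I) = 0"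
      proof
        fix B assume B: "B \<in> V"
        show "subpermanent (M m B) I (s ` I) = 0"
        proof (cases "\<exists>i\<in>I. f i = m")
          case False
          then have "subpermanent (M m B) I (s ` I) = subpermanent (M (Suc m) B) I (s ` I)"
            by (intro subpermanent_cong) (auto simp: M_def Suc_le_eq le_less)
          then show ?thesis using IH B by simp
        next
          case True
          then obtain r where r: "r \<in> I" "f r = m" by blast
          have BA: "B + A r \<in> V" using V B A(1)[OF r(1)] by (simp add: mat.subspace_add)
          have other: "f i \<noteq> m" if "i \<noteq> r" for i using that r(2) f by (auto dest: injD)
          have above: "A r $ i $ j = 0" if "f i < m" for i j
            using A(2)[OF r(1)] that r(2) by (auto simp: leading_def)
          \<comment> \<open>Row \<open>r\<close> of \<open>M (Suc m) (B + A r)\<close> is row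
            \<open>r\<close> of \<open>M m B\<close> plus row \<open>r\<close> of
            \<open>M (Suc m) B\<close>. The rows before \<open>r\<close> are unchanged because
            \<open>A r\<close> vanishes there, and those after it are already replaced.\<close>
          have "subpermanent (M (Suc m) (B + A r)) I (s ` I) =
              subpermanent (M m B) I (s ` I) + subpermanent (M (Suc m) B) I (s ` I)"
          proof (rule subpermanent_add_row[OF r(1)])
            fix i j assume i: "i \<in> I - {r}"
            then have "f i \<noteq> m" using other by blast
            then show "M m B $ i $ j = M (Suc m) B $ i $ j"
              "M (Suc m) (B + A r) $ i $ j = M (Suc m) B $ i $ j"
              using above[of i j] by (auto simp: M_def)
          qed (use r in \<open>auto simp: M_def\<close>)
          then show ?thesis using IH BA B by simp
        qed
      qed
    qed
  qed
  from this[of N] have "subpermanent (M 0 0) I (s ` I) = 0"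
    using mat.subspace_0[OF V] by simp
  moreover have "subpermanent (M 0 0) I (s ` I) \<noteq> 0"
    using A(2) by (intro subpermanent_triangular[OF f s]) (auto simp: M_def leading_def)
  ultimately show False by contradiction
qed

section \<open>Position sets meeting every permutation in few positions\<close>

text \<open>Composition with the transpositions of \<open>j\<close>, \<open>j'\<close> and of
  \<open>i\<close>, \<open>i'\<close> is an involution on permutations that exchanges the two
  sets.\<close>

lemma card_permutations_through:
  fixes i j i' j' :: "'n::finite"
  shows "card {\<sigma>. \<sigma> permutes UNIV \<and> \<sigma> i = j} = card {\<sigma>. \<sigma> permutes UNIV \<and> \<sigma> i' = j'}"
proof (rule bij_betw_same_card)
  let ?h = "\<lambda>\<sigma>. Transposition.transpose j j' \<circ> \<sigma> \<circ> Transposition.transpose i i'"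
  have t: "Transposition.transpose a b permutes UNIV" for a b :: 'n
    by (rule permutes_swap_id) auto
  show "bij_betw ?h {\<sigma>. \<sigma> permutes UNIV \<and> \<sigma> i = j} {\<sigma>. \<sigma> permutes UNIV \<and> \<sigma> i' = j'}"
    by (rule bij_betw_byWitness[where f' = ?h])
      (auto simp: fun_eq_iff intro!: permutes_compose t)
qed

text \<open>Count the pairs of a permutation and a position of \<open>L\<close> on its graph. Each
  position lies on \<open>N\<close> of the \<open>CARD('n) * N\<close> permutations, so on average a
  permutation meets \<open>card L / CARD('n)\<close> positions, which is at least \<open>k\<close>.
  As none meets more than \<open>k\<close>, all meet exactly \<open>k\<close>.\<close>

lemma card_meet_permutation:
  fixes L :: "('n::finite \<times> 'n) set"
  assumes le: "\<And>\<sigma>. \<sigma> permutes UNIV \<Longrightarrow> card {i. (i, \<sigma> i) \<in> L} \<le> k"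
    and big: "CARD('n) * k \<le> card L" and "\<sigma> permutes UNIV"
  shows "card {i. (i, \<sigma> i) \<in> L} = k" and "card L = CARD('n) * k"
proof -
  let ?P = "{\<sigma> :: 'n \<Rightarrow> 'n. \<sigma> permutes UNIV}"
  obtain a :: 'n where True by simp
  define N where "N = card {\<sigma> :: 'n \<Rightarrow> 'n. \<sigma> permutes UNIV \<and> \<sigma> a = a}"
  have fin: "finite ?P" by (simp add: finite_permutations)
  have N: "card {\<sigma>\<in>?P. \<sigma> i = j} = N" for i j
    unfolding N_def using card_permutations_through[of i j a a] by simp
  \<comment> \<open>Partition the permutations by their value at \<open>a\<close>.\<close>
  have "card ?P = (\<Sum>j\<in>UNIV. card {\<sigma>\<in>?P. \<sigma> a = j})"
    using sum.group[OF fin finite, of "\<lambda>\<sigma>. \<sigma> a" UNIV "\<lambda>_. 1::nat"] by simp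
  then have cP: "card ?P = CARD('n) * N" by (simp only: N) simp
  have "(\<Sum>\<sigma>\<in>?P. card {i. (i, \<sigma> i) \<in> L}) = (\<Sum>\<sigma>\<in>?P. \<Sum>p\<in>L. if \<sigma> (fst p) = snd p then 1 else 0)"
  proof (rule sum.cong[OF refl])
    fix \<sigma> :: "'n \<Rightarrow> 'n"
    have "bij_betw (\<lambda>i. (i, \<sigma> i)) {i. (i, \<sigma> i) \<in> L} {p\<in>L. \<sigma> (fst p) = snd p}"
      by (rule bij_betw_byWitness[where f' = fst]) auto
    then show "card {i. (i, \<sigma> i) \<in> L} = (\<Sum>p\<in>L. if \<sigma> (fst p) = snd p then 1 else 0)"
      by (simp add: bij_betw_same_card sum.If_cases Int_def)
  qed
  also have "\<dots> = (\<Sum>p\<in>L. \<Sum>\<sigma>\<in>?P. if \<sigma> (fst p) = snd p then 1 else 0)"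
    by (rule sum.swap)
  also have "\<dots> = (\<Sum>p\<in>L. N)"
    using fin by (intro sum.cong refl) (simp add: sum.If_cases Int_def N[simplified])
  finally have total: "(\<Sum>\<sigma>\<in>?P. card {i. (i, \<sigma> i) \<in> L}) = card L * N" by simp
  have ub: "(\<Sum>\<sigma>\<in>?P. card {i. (i, \<sigma> i) \<in> L}) \<le> card ?P * k"
    using sum_bounded_above[of ?P "\<lambda>\<sigma>. card {i. (i, \<sigma> i) \<in> L}" k] le by simp
  have "card ?P > 0" using fin assms(3) by (auto simp: card_gt_0_iff)
  then have "N > 0" using cP by simp
  then show cL: "card L = CARD('n) * k"
    using ub big unfolding total cP by (auto simp: mult.commute mult.left_commute)
  show "card {i. (i, \<sigma> i) \<in> L} = k"
  proof (rule ccontr)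
    assume "card {i. (i, \<sigma> i) \<in> L} \<noteq> k"
    then have "card {i. (i, \<sigma> i) \<in> L} < k" using le assms(3) by (simp add: le_neq_implies_less)
    then have "(\<Sum>\<sigma>\<in>?P. card {i. (i, \<sigma> i) \<in> L}) < (\<Sum>\<sigma>\<in>?P. k)"
      using le assms(3) fin by (intro sum_strict_mono_ex1) auto
    then show False unfolding total cL using cP by (simp add: ac_simps)
  qed
qed

lemma permutation_through_two:
  fixes i j a b :: 'n
  assumes "i \<noteq> j" "a \<noteq> b"
  obtains \<sigma> where "\<sigma> permutes UNIV" "\<sigma> i = a" "\<sigma> j = b"
proof
  \<comment> \<open>The transposition applied first sends \<open>i\<close> to \<open>a\<close> and
    \<open>j\<close> to something other than \<open>a\<close>; the second one moves that to
    \<open>b\<close> and fixes \<open>a\<close>.\<close>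
  show "Transposition.transpose b (Transposition.transpose i a j) \<circ> Transposition.transpose i a permutes UNIV"
    by (auto intro!: permutes_compose permutes_swap_id)
qed (use assms in \<open>auto simp: Transposition.transpose_def\<close>)

text \<open>Composing a permutation with a transposition changes only two of its positions, so the
  indicator \<open>l\<close> of \<open>L\<close> satisfies the exchange identity \<open>swap\<close>
  on every two by two block. A 0-1 array of this kind depends on the row alone or on the column
  alone.\<close>

lemma lines_from_constant_meet:
  fixes L :: "('n::finite \<times> 'n) set"
  assumes const: "\<And>\<sigma>. \<sigma> permutes UNIV \<Longrightarrow> card {i. (i, \<sigma> i) \<in> L} = k"
    and card: "card L = CARD('n) * k"
  shows "(\<exists>I. card I = k \<and> L = I \<times> UNIV) \<or> (\<exists>J. card J = k \<and> L = UNIV \<times> J)"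
proof -
  define l where "l i j = (if (i, j) \<in> L then 1 else 0 :: nat)" for i j
  have cl: "card {i. (i, \<sigma> i) \<in> L} = (\<Sum>i\<in>UNIV. l i (\<sigma> i))" for \<sigma>
    by (simp add: l_def sum.If_cases)
  have swap: "l i a + l j b = l i b + l j a" if "i \<noteq> j" "a \<noteq> b" for i j a b
  proof -
    obtain \<sigma> where \<sigma>: "\<sigma> permutes UNIV" "\<sigma> i = a" "\<sigma> j = b"
      using permutation_through_two[OF \<open>i \<noteq> j\<close> \<open>a \<noteq> b\<close>] .
    let ?\<tau> = "\<sigma> \<circ> Transposition.transpose i j"
    have \<tau>: "?\<tau> permutes UNIV"
      using \<sigma>(1) by (intro permutes_compose[OF permutes_swap_id]) auto
    have dec: "(\<Sum>x\<in>UNIV. g x) = g i + g j + (\<Sum>x\<in>UNIV-{i,j}. g x)" for g :: "'n \<Rightarrow> nat"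
    proof -
      have "UNIV - {i, j} = UNIV - {i} - {j}" by auto
      then show ?thesis using that
        by (simp add: sum.remove[of UNIV i g] sum.remove[of "UNIV - {i}" j g])
    qed
    have "(\<Sum>x\<in>UNIV-{i,j}. l x (\<sigma> x)) = (\<Sum>x\<in>UNIV-{i,j}. l x (?\<tau> x))"
      by (rule sum.cong) (auto simp: Transposition.transpose_def)
    moreover have "(\<Sum>x\<in>UNIV. l x (\<sigma> x)) = (\<Sum>x\<in>UNIV. l x (?\<tau> x))"
      using const[OF \<sigma>(1)] const[OF \<tau>] unfolding cl by simp
    ultimately show ?thesis using \<sigma> by (simp add: dec)
  qed
  have pos: "CARD('n) > 0" by simp
  show ?thesis
  proof (cases "\<exists>i j b. l i b \<noteq> l j b")
    case True
    then obtain i j b where ij: "l i b = 1" "l j b = 0"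
      by (metis l_def)
    then have "i \<noteq> j" by auto
    \<comment> \<open>For \<open>a \<noteq> b\<close> the exchange identity reads
      \<open>l i a = 1 + l j a\<close>, and \<open>l\<close> takes only the values 0 and 1.\<close>
    have la: "l i a = 1" for a
      using swap[OF \<open>i \<noteq> j\<close>, of a b] ij by (cases "a = b") (auto simp: l_def split: if_splits)
    \<comment> \<open>Exchange against row \<open>i\<close>, which is constantly 1.\<close>
    have "l m a = l m b" for m a
      using swap[of m i a b] la by (cases "m = i"; cases "a = b") auto
    then have "(m, a) \<in> L \<longleftrightarrow> (m, b) \<in> L" for m a
      by (metis l_def zero_neq_one)
    then have "L = {m. (m, b) \<in> L} \<times> UNIV" by auto
    then obtain I where I: "L = I \<times> UNIV" by blast
    then have "card I * CARD('n) = CARD('n) * k" using card by (simp add: card_cartesian_product)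
    then show ?thesis using I pos by auto
  next
    case False
    then have "(m, a) \<in> L \<longleftrightarrow> (m', a) \<in> L" for m m' a
      by (metis l_def zero_neq_one)
    then have "L = UNIV \<times> {a. (undefined, a) \<in> L}" by auto
    then obtain J where J: "L = UNIV \<times> J" by blast
    then have "CARD('n) * card J = CARD('n) * k" using card by (simp add: card_cartesian_product)
    then show ?thesis using J pos by auto
  qed
qed

section \<open>Subspaces of maximal dimension\<close>

text \<open>Besides \<open>i\<close>, the set \<open>I\<close> has at most
  \<open>CARD('n) - 2\<close> rows, and this is the number of columns other than \<open>c\<close>
  and \<open>c'\<close>.\<close>

lemma injection_avoiding_two:
  fixes I :: "'n::finite set" and c c' :: 'n
  assumes "i \<in> I" "card I < CARD('n)" "c \<noteq> c'"
  obtains s :: "'n \<Rightarrow> 'n" where "inj_on s (I - {i})" "s ` (I - {i}) \<inter> {c, c'} = {}"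
proof -
  have "card (I - {i}) \<le> card (UNIV - {c, c'})"
    using assms by (simp add: card_Diff_subset)
  then obtain s where "s ` (I - {i}) \<subseteq> UNIV - {c, c'}" "inj_on s (I - {i})"
    using card_le_inj[of "I - {i}" "UNIV - {c, c'}"] by auto
  then show thesis using that by blast
qed

text \<open>By \<open>det\<close> and the dimension, masking is a bijection from \<open>V\<close>
  onto \<open>coord_space (I \<times> UNIV)\<close>. Each matrix unit in the rows \<open>I\<close>
  thus has a preimage \<open>G i c\<close> in \<open>V\<close>, and the point is that this preimage
  is zero outside those rows.\<close>

lemma max_dim_subspace_over_rows:
  fixes V :: "('a::field ^ 'n ^ 'n) set"
  assumes two: "(2::'a) \<noteq> 0" and n: "CARD('n) \<ge> 3" and I: "card I < CARD('n)"
    and V: "mat.subspace V" "V \<subseteq> \<Lambda>\<^sub>\<le> (card I)" "mat.dim V = CARD('n) * card I"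
    and det: "\<And>A. A \<in> V \<Longrightarrow> mat_mask (I \<times> UNIV) A = 0 \<Longrightarrow> A = 0"
  shows "V = coord_space (I \<times> UNIV)"
proof -
  let ?m = "mat_mask (I \<times> UNIV) :: 'a ^ 'n ^ 'n \<Rightarrow> _"
  have inj: "inj_on ?m V" using V(1) det by (rule inj_on_mat_mask)
  have img: "?m ` V = coord_space (I \<times> UNIV)"
  proof (rule mat.subspace_dim_equal)
    show "mat.subspace (?m ` V)"
      by (rule mat.linear_subspace_image[OF linear_mat_mask V(1)])
    show "mat.dim (coord_space (I \<times> UNIV) :: ('a ^ 'n ^ 'n) set) \<le> mat.dim (?m ` V)"
      using V(1,3) inj by (simp add: dim_linear_image linear_mat_mask dim_coord_space card_cartesian_product)
  qed (auto simp: subspace_coord_space mat_mask_in_coord_space)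
  have "\<exists>A\<in>V. ?m A = mat_unit (i, c)" if "i \<in> I" for i c
  proof -
    have "mat_unit (i, c) \<in> ?m ` V"
      using that unfolding img by (auto simp: coord_space_def)
    then show ?thesis by (metis imageE)
  qed
  then obtain G where GV: "\<And>i c. i \<in> I \<Longrightarrow> G i c \<in> V"
    and Gm: "\<And>i c. i \<in> I \<Longrightarrow> ?m (G i c) = mat_unit (i, c)"
    by metis
  have G: "G i c $ i' $ j = (if i' = i \<and> j = c then 1 else 0)" if "i \<in> I" "i' \<in> I" for i c i' j
    using arg_cong[OF Gm[OF that(1), of c], of "\<lambda>A. A $ i' $ j"] that by (simp cong: if_cong)
  \<comment> \<open>In the rows \<open>I - {i}\<close> the combination \<open>B\<close> has single
    ones in the columns \<open>s i'\<close>, and in row \<open>i\<close> it has \<open>x\<close> and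
    \<open>y\<close> in the columns \<open>c\<close> and \<open>c'\<close>. With row
    \<open>r\<close> added, the permanent of size \<open>card I + 1\<close> collapses to that of a
    two by two array, and it vanishes as \<open>B\<close> lies in \<open>V\<close>.\<close>
  have key: "x * (x * G i c $ r $ c' + y * G i c' $ r $ c' + (\<Sum>i'\<in>I-{i}. G i' (s i') $ r $ c')) +
      y * (x * G i c $ r $ c + y * G i c' $ r $ c + (\<Sum>i'\<in>I-{i}. G i' (s i') $ r $ c)) = 0"
    if i: "i \<in> I" and r: "r \<notin> I" and c: "c \<noteq> c'"
      and s: "inj_on s (I - {i})" "s ` (I - {i}) \<inter> {c, c'} = {}" for i r c c' s x y
  proof -
    let ?I = "I - {i}"
    define B where "B = mat_scale x (G i c) + mat_scale y (G i c') + (\<Sum>i'\<in>?I. G i' (s i'))"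
    have BV: "B \<in> V"
      unfolding B_def using V(1) GV i
      by (intro mat.subspace_add mat.subspace_scale mat.subspace_sum) auto
    have Brow: "B $ i' $ j = (if j = s i' then 1 else 0)" if "i' \<in> ?I" for i' j
    proof -
      have "(\<Sum>l\<in>?I. G l (s l) $ i' $ j) = (\<Sum>l\<in>?I. if l = i' then (if j = s i' then 1 else 0) else 0)"
        using that by (intro sum.cong refl) (auto simp: G)
      then show ?thesis using that i by (simp add: B_def sum_mat_nth G)
    qed
    have Bi: "B $ i $ c = x" "B $ i $ c' = y"
      using i c by (auto simp: B_def sum_mat_nth G intro!: sum.neutral split: if_splits)
    have "subpermanent B (?I \<union> {i, r}) (s ` ?I \<union> {c, c'}) =
        (\<Prod>i'\<in>?I. B $ i' $ s i') * subpermanent B {i, r} {c, c'}"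
      using s r by (intro subpermanent_monomial_rows) (auto simp: Brow)
    also have "(\<Prod>i'\<in>?I. B $ i' $ s i') = 1" by (simp add: Brow)
    also have "subpermanent B {i, r} {c, c'} = x * B $ r $ c' + y * B $ r $ c"
      using i r c by (subst subpermanent_doubleton) (auto simp: Bi)
    finally have eq: "subpermanent B (?I \<union> {i, r}) (s ` ?I \<union> {c, c'}) = x * B $ r $ c' + y * B $ r $ c"
      by simp
    have "?I \<union> {i, r} = insert r I" using i by auto
    then have c1: "card (?I \<union> {i, r}) = Suc (card I)" using r by simp
    have "card (s ` ?I \<union> {c, c'}) = card ?I + 2"
      using s c by (simp add: card_Un_disjoint card_image)
    also have "\<dots> = Suc (card I)" using card_Suc_Diff1[OF finite i] by linarith
    finally have "card (?I \<union> {i, r}) = card (s ` ?I \<union> {c, c'})" using c1 by simp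
    then have "subpermanent B (?I \<union> {i, r}) (s ` ?I \<union> {c, c'}) = 0"
      using c1 BV V(2) by (intro subpermanent_eq_0[of B "card I"]) auto
    then show ?thesis unfolding eq by (simp add: B_def sum_mat_nth)
  qed
  have off: "G i c $ r $ c' = 0" if i: "i \<in> I" and r: "r \<notin> I" and c: "c \<noteq> c'" for i r c c'
  proof -
    obtain s where s: "inj_on s (I - {i})" "s ` (I - {i}) \<inter> {c, c'} = {}"
      using injection_avoiding_two[OF i I c] .
    \<comment> \<open>At \<open>y = 0\<close> the identity reads \<open>x * (x * g + t) = 0\<close>,
      where \<open>g\<close> is the entry in question and \<open>t\<close> the sum;
      \<open>x = 1\<close> and \<open>x = -1\<close> together give \<open>2 * g = 0\<close>.\<close>
    show ?thesis
      using key[OF i r c s, of 1 0] key[OF i r c s, of "-1" 0] two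
      by (simp add: add_eq_0_iff)
  qed
  have pair: "G i c $ r $ c + G i c' $ r $ c' = 0"
    if i: "i \<in> I" and r: "r \<notin> I" and c: "c \<noteq> c'" for i r c c'
  proof -
    obtain s where s: "inj_on s (I - {i})" "s ` (I - {i}) \<inter> {c, c'} = {}"
      using injection_avoiding_two[OF i I c] .
    \<comment> \<open>The columns \<open>s i'\<close> differ from \<open>c\<close> and
      \<open>c'\<close>, so \<open>off\<close> kills these sums; then \<open>x = y = 1\<close>
      isolates the two terms with matching columns.\<close>
    have "(\<Sum>i'\<in>I-{i}. G i' (s i') $ r $ d) = 0" if "d \<in> {c, c'}" for d
      using that s(2) r by (intro sum.neutral ballI off) auto
    then show ?thesis
      using key[OF i r c s, of 1 1] off[OF i r c] off[OF i r c[symmetric]] by (simp add: add.commute)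
  qed
  have diag: "G i c $ r $ c = 0" if i: "i \<in> I" and r: "r \<notin> I" for i r c
  proof -
    \<comment> \<open>Three distinct columns give three values with zero pairwise sums, and these
      are zero in characteristic other than 2.\<close>
    have "\<not> UNIV \<subseteq> {c}" using n card_mono[of "{c}" UNIV] by fastforce
    then obtain d where d: "d \<noteq> c" by auto
    have "card {c, d} \<le> 2" by (simp add: card_insert_if)
    then have "\<not> UNIV \<subseteq> {c, d}" using n card_mono[of "{c, d}" UNIV] by fastforce
    then obtain e where e: "e \<noteq> c" "e \<noteq> d" by auto
    have "G i c $ r $ c + G i d $ r $ d = 0" "G i c $ r $ c + G i e $ r $ e = 0"
      "G i d $ r $ d + G i e $ r $ e = 0"
      using d e by (auto intro!: pair[OF i r])
    then have "2 * G i c $ r $ c = 0" by algebra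
    then show ?thesis using two by simp
  qed
  have unit: "G i c = mat_unit (i, c)" if "i \<in> I" for i c
    using that G off diag by (auto simp: vec_eq_iff) (metis+)
  have "coord_space (I \<times> UNIV) \<subseteq> V"
    unfolding coord_space_eq_span
    using GV V(1) by (intro mat.span_minimal) (auto simp: unit)
  moreover have "mat.dim V \<le> mat.dim (coord_space (I \<times> UNIV) :: ('a ^ 'n ^ 'n) set)"
    by (simp add: V(3) dim_coord_space card_cartesian_product)
  ultimately show ?thesis
    using mat.subspace_dim_equal[OF subspace_coord_space V(1)] by blast
qed

lemma transpose_image_coord_space:
  "transpose ` coord_space S = (coord_space (prod.swap ` S) :: ('a::zero ^ 'n ^ 'n) set)"
proof -
  have "transpose A \<in> coord_space (prod.swap ` S)" if "A \<in> coord_space S"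
    for A :: "'a ^ 'n ^ 'n" and S
  proof -
    have "(j, i) \<notin> S" if "(i, j) \<notin> prod.swap ` S" for i j
      using that image_eqI[of "(i, j)" prod.swap "(j, i)" S] by auto
    then show ?thesis using that by (auto simp: coord_space_def transpose_def)
  qed
  from this[of _ S] this[of _ "prod.swap ` S"] show ?thesis
    by (auto simp: image_image) (metis image_eqI transpose_transpose)
qed

text \<open>The leading set \<open>L\<close> meets a permutation in at most \<open>k\<close>
  positions, since these support a nonzero permanent of some member of \<open>V\<close>. As
  \<open>card L\<close> is at least \<open>CARD('n) * k\<close>, it consists of \<open>k\<close>
  full rows or columns, and members of \<open>V\<close> are determined by their entries
  there.\<close>

lemma max_dim_subspace_is_coord_space:
  fixes V :: "('a::field ^ 'n ^ 'n) set"
  assumes two: "(2::'a) \<noteq> 0" and n: "CARD('n) \<ge> 3" and k: "k < CARD('n)"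
    and V: "mat.subspace V" "V \<subseteq> \<Lambda>\<^sub>\<le> k" "mat.dim V = CARD('n) * k"
  shows "\<exists>S. V = coord_space S"
proof -
  obtain f :: "'n \<Rightarrow> nat" where f: "inj f"
    using finite_imp_inj_to_nat_seg[of "UNIV :: 'n set"] by auto
  define L where "L = leading_set f V"
  have le: "card {i. (i, \<sigma> i) \<in> L} \<le> k" if \<sigma>: "\<sigma> permutes UNIV" for \<sigma>
  proof -
    let ?I = "{i. (i, \<sigma> i) \<in> L}"
    have inj: "inj_on \<sigma> ?I" using \<sigma> by (auto intro: inj_on_subset permutes_inj)
    obtain B where "B \<in> V" "subpermanent B ?I (\<sigma> ` ?I) \<noteq> 0"
      using nonzero_subpermanent_from_leading_matching[OF V(1) f inj] by (auto simp: L_def)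
    then show ?thesis
      using prk_geI[of ?I "\<sigma> ` ?I" B] V(2) inj by (force simp: card_image prk_le_def)
  qed
  have big: "CARD('n) * k \<le> card L"
    using dim_le_card_leading_set[OF V(1), of f] V(3) by (simp add: L_def)
  have det: "A = 0" if "A \<in> V" "mat_mask L A = 0" for A
    using mat_mask_leading_set[of A V f L] that by (simp add: L_def)
  have "(\<exists>I. card I = k \<and> L = I \<times> UNIV) \<or> (\<exists>J. card J = k \<and> L = UNIV \<times> J)"
    using card_meet_permutation[OF le big] permutes_id by (intro lines_from_constant_meet) blast+
  then show ?thesis
  proof (elim disjE exE conjE)
    fix I assume "card I = k" "L = I \<times> UNIV"
    then have "V = coord_space (I \<times> UNIV)"
      using assms det by (intro max_dim_subspace_over_rows) auto
    then show ?thesis ..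
  next
    fix J assume J: "card J = k" "L = UNIV \<times> J"
    \<comment> \<open>The column case becomes the row case: members of the transposed space are
      determined by their entries in the rows \<open>J\<close>.\<close>
    have "transpose ` V = coord_space (J \<times> UNIV)"
    proof (rule max_dim_subspace_over_rows[OF two n])
      show "mat.subspace (transpose ` V)"
        by (rule mat.linear_subspace_image[OF linear_transpose V(1)])
      show "mat.dim (transpose ` V) = CARD('n) * card J"
      proof (subst dim_linear_image[OF linear_transpose V(1)])
        show "inj_on transpose V" by (rule inj_onI) (metis transpose_transpose)
      qed (use V(3) J(1) in simp)
      fix A assume "A \<in> transpose ` V" and A: "mat_mask (J \<times> UNIV) A = 0"
      then obtain B where B: "B \<in> V" "A = transpose B" by blast
      have "B $ i $ j = 0" if "j \<in> J" for i j
        using arg_cong[OF A, of "\<lambda>A. A $ j $ i"] that by (simp add: B(2) transpose_def)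
      then have "mat_mask L B = 0" by (simp add: vec_eq_iff J(2))
      then show "A = 0" using det[OF B(1)] B(2) by (simp add: vec_eq_iff transpose_def)
    qed (use k J V(2) in auto)
    then have "transpose ` transpose ` V = coord_space (prod.swap ` (J \<times> UNIV))"
      by (simp add: transpose_image_coord_space)
    then show ?thesis by (auto simp: image_image)
  qed
qed

section \<open>Symmetries of the positions\<close>

text \<open>Collinear positions have collinear images, and row \<open>i\<close> fills an image row.
  Another row mapped into a column would fill that column and cross this image row, against
  injectivity. So all rows go to rows, and collinearity within columns then yields
  \<open>\<tau>\<close>.\<close>

lemma rook_automorphism_preserving_a_row:
  fixes \<pi> :: "'n::finite \<times> 'n \<Rightarrow> 'n \<times> 'n"
  assumes inj: "inj \<pi>"
    and nc: "\<And>p q. fst p \<noteq> fst q \<and> snd p \<noteq> snd q \<longleftrightarrow>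
      fst (\<pi> p) \<noteq> fst (\<pi> q) \<and> snd (\<pi> p) \<noteq> snd (\<pi> q)"
    and row: "a \<noteq> b" "fst (\<pi> (i, a)) = fst (\<pi> (i, b))"
  shows "\<exists>\<sigma> \<tau>. inj \<sigma> \<and> inj \<tau> \<and> (\<forall>i j. \<pi> (i, j) = (\<sigma> i, \<tau> j))"
proof -
  have coll: "fst (\<pi> (m, x)) = fst (\<pi> (m, y)) \<or> snd (\<pi> (m, x)) = snd (\<pi> (m, y))" for m x y
    using nc[of "(m, x)" "(m, y)"] by auto
  have ne: "\<pi> (m, x) \<noteq> \<pi> (m, y)" if "x \<noteq> y" for m x y
    using inj that by (auto dest: injD)
  \<comment> \<open>Otherwise the image of \<open>(m, z)\<close> would share its column with the
    distinct images of \<open>(m, x)\<close> and \<open>(m, y)\<close>, which lie in one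
    row.\<close>
  have sameF: "fst (\<pi> (m, z)) = fst (\<pi> (m, x))"
    if "x \<noteq> y" "fst (\<pi> (m, x)) = fst (\<pi> (m, y))" for m x y z
    using that ne[OF that(1), of m] coll[of m z x] coll[of m z y] by (metis prod.collapse)
  have sameS: "snd (\<pi> (m, z)) = snd (\<pi> (m, x))"
    if "x \<noteq> y" "snd (\<pi> (m, x)) = snd (\<pi> (m, y))" for m x y z
    using that ne[OF that(1), of m] coll[of m z x] coll[of m z y] by (metis prod.collapse)
  have full_row: "\<exists>z. \<pi> (i, z) = (fst (\<pi> (i, a)), c)" for c
  proof -
    have "inj (\<lambda>z. snd (\<pi> (i, z)))"
      using ne[of _ _ i] sameF[OF row] by (intro injI) (metis prod.collapse)
    then have "surj (\<lambda>z. snd (\<pi> (i, z)))" by (simp add: finite_UNIV_inj_surj)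
    then obtain z where "c = snd (\<pi> (i, z))" by (auto simp: surj_def)
    then show ?thesis using sameF[OF row, of z] by (metis prod.collapse)
  qed
  have rows: "fst (\<pi> (m, x)) = fst (\<pi> (m, y))" for m x y
  proof (cases "fst (\<pi> (m, a)) = fst (\<pi> (m, b))")
    case True
    then show ?thesis using sameF[OF row(1)] by metis
  next
    case False
    then have m: "m \<noteq> i" using row by auto
    have snd: "snd (\<pi> (m, a)) = snd (\<pi> (m, b))" using False coll by blast
    have "inj (\<lambda>z. fst (\<pi> (m, z)))"
      using ne[of _ _ m] sameS[OF row(1) snd] by (intro injI) (metis prod.collapse)
    then have "surj (\<lambda>z. fst (\<pi> (m, z)))" by (simp add: finite_UNIV_inj_surj)
    then obtain z where "fst (\<pi> (i, a)) = fst (\<pi> (m, z))" by (auto simp: surj_def)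
    then have "\<pi> (m, z) = (fst (\<pi> (i, a)), snd (\<pi> (m, a)))"
      using sameS[OF row(1) snd, of z] by (metis prod.collapse)
    moreover obtain z' where "\<pi> (i, z') = (fst (\<pi> (i, a)), snd (\<pi> (m, a)))"
      using full_row by blast
    ultimately show ?thesis using inj m by (metis injD Pair_inject)
  qed
  define \<sigma> where "\<sigma> m = fst (\<pi> (m, a))" for m
  define \<tau> where "\<tau> j = snd (\<pi> (i, j))" for j
  have \<sigma>: "fst (\<pi> (m, x)) = \<sigma> m" for m x unfolding \<sigma>_def by (rule rows)
  have inj\<sigma>: "inj \<sigma>"
  proof (rule injI, rule ccontr)
    fix m m' assume "\<sigma> m = \<sigma> m'" "m \<noteq> m'"
    then show False using nc[of "(m, a)" "(m', b)"] row(1) \<sigma> by simp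
  qed
  have \<tau>: "snd (\<pi> (m, j)) = \<tau> j" for m j
  proof (cases "m = i")
    case False
    then have "\<sigma> m \<noteq> \<sigma> i" using inj\<sigma> by (auto dest: injD)
    then show ?thesis using nc[of "(m, j)" "(i, j)"] \<sigma> by (simp add: \<tau>_def)
  qed (simp add: \<tau>_def)
  have eq: "\<pi> (m, j) = (\<sigma> m, \<tau> j)" for m j by (metis \<sigma> \<tau> prod.collapse)
  then have "inj \<tau>" using inj by (metis Pair_inject injD injI)
  with inj\<sigma> eq show ?thesis by blast
qed

text \<open>The map induced by \<open>\<pi>\<close> on pairs is injective on the finite set of
  non-collinear pairs, hence onto it, so non-collinearity is also reflected. Composing with a swap
  if necessary, two positions of one row stay in one row.\<close>

lemma rook_automorphism:
  fixes \<pi> :: "'n::finite \<times> 'n \<Rightarrow> 'n \<times> 'n"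
  assumes n: "CARD('n) \<ge> 2" and inj: "inj \<pi>"
    and pres: "\<And>p q. fst p \<noteq> fst q \<Longrightarrow> snd p \<noteq> snd q \<Longrightarrow>
      fst (\<pi> p) \<noteq> fst (\<pi> q) \<and> snd (\<pi> p) \<noteq> snd (\<pi> q)"
  shows "\<exists>\<sigma> \<tau>. inj \<sigma> \<and> inj \<tau> \<and>
    ((\<forall>i j. \<pi> (i, j) = (\<sigma> i, \<tau> j)) \<or> (\<forall>i j. \<pi> (i, j) = (\<tau> j, \<sigma> i)))"
proof -
  let ?N = "{(p, q). fst p \<noteq> fst q \<and> snd p \<noteq> snd q} :: (('n \<times> 'n) \<times> ('n \<times> 'n)) set"
  have "map_prod \<pi> \<pi> ` ?N = ?N"
  proof (rule endo_inj_surj)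
    show "map_prod \<pi> \<pi> ` ?N \<subseteq> ?N" using pres by auto
    show "inj_on (map_prod \<pi> \<pi>) ?N"
      using prod.inj_map[OF inj inj] by (rule inj_on_subset) simp
  qed simp
  then have refl_nc: "(p, q) \<in> ?N" if "(\<pi> p, \<pi> q) \<in> ?N" for p q
  proof -
    have "(\<pi> p, \<pi> q) \<in> map_prod \<pi> \<pi> ` ?N"
      using that \<open>map_prod \<pi> \<pi> ` ?N = ?N\<close> by simp
    then obtain p' q' where "(p', q') \<in> ?N" "\<pi> p = \<pi> p'" "\<pi> q = \<pi> q'"
      by auto
    moreover from this have "p = p'" "q = q'" using injD[OF inj] by blast+
    ultimately show ?thesis by simp
  qed
  have nc: "fst p \<noteq> fst q \<and> snd p \<noteq> snd q \<longleftrightarrow>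
      fst (\<pi> p) \<noteq> fst (\<pi> q) \<and> snd (\<pi> p) \<noteq> snd (\<pi> q)" for p q
    using pres[of p q] refl_nc[of p q, simplified] by blast
  obtain a b :: 'n where ab: "a \<noteq> b"
    using n card_le_Suc0_iff_eq[of "UNIV :: 'n set"] by auto
  show ?thesis
  proof (cases "fst (\<pi> (a, a)) = fst (\<pi> (a, b))")
    case True
    show ?thesis
      using rook_automorphism_preserving_a_row[OF inj nc ab True] by blast
  next
    case False
    then have "snd (\<pi> (a, a)) = snd (\<pi> (a, b))" using nc[of "(a, a)" "(a, b)"] by auto
    then have "\<exists>\<sigma> \<tau>. inj \<sigma> \<and> inj \<tau> \<and> (\<forall>i j. (prod.swap \<circ> \<pi>) (i, j) = (\<sigma> i, \<tau> j))"
    proof (intro rook_automorphism_preserving_a_row[OF _ _ ab])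
      show "inj (prod.swap \<circ> \<pi>)" by (rule inj_compose[OF _ inj]) simp
      show "fst p \<noteq> fst q \<and> snd p \<noteq> snd q \<longleftrightarrow>
          fst ((prod.swap \<circ> \<pi>) p) \<noteq> fst ((prod.swap \<circ> \<pi>) q) \<and>
          snd ((prod.swap \<circ> \<pi>) p) \<noteq> snd ((prod.swap \<circ> \<pi>) q)" for p q
        using nc[of p q] by auto
    qed simp
    then show ?thesis by (metis comp_apply swap_simp swap_swap)
  qed
qed

section \<open>Monomial equivalences\<close>

lemma subpermanent_permute_columns:
  assumes "inj \<tau>"
  shows "subpermanent (\<chi> i j. A $ i $ \<tau> j) I J = subpermanent A I (\<tau> ` J)"
  unfolding subpermanent_def
proof (rule sum.reindex_bij_witness[where j = "\<lambda>f. restrict (\<tau> \<circ> f) I"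
      and i = "\<lambda>g. restrict (inv \<tau> \<circ> g) I"], goal_cases)
  case (1 f)
  then show ?case using assms by (auto simp: fun_eq_iff PiE_iff extensional_def)
next
  case (2 f)
  then have "bij_betw (\<tau> \<circ> f) I (\<tau> ` J)"
    using assms by (auto intro!: bij_betw_trans inj_on_imp_bij_betw intro: inj_on_subset)
  then show ?case by (auto simp: bij_betw_def inj_on_restrict_eq)
next
  case (3 g)
  then have "g i = \<tau> (inv \<tau> (g i))" if "i \<in> I" for i
    using that assms by (auto simp: PiE_iff f_inv_into_f)
  then show ?case using 3 by (auto simp: fun_eq_iff PiE_iff extensional_def)
next
  case (4 g)
  have "bij_betw (inv \<tau>) (\<tau> ` J) J"
    using assms by (intro bij_betw_byWitness[where f' = \<tau>]) auto
  then have "bij_betw (inv \<tau> \<circ> g) I J" using 4 by (auto intro: bij_betw_trans)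
  then show ?case by (auto simp: bij_betw_def inj_on_restrict_eq)
next
  case (5 f)
  then show ?case by (auto intro!: prod.cong)
qed

lemma subpermanent_permute:
  assumes "inj \<sigma>" "inj \<tau>"
  shows "subpermanent (\<chi> i j. A $ \<sigma> i $ \<tau> j) I J = subpermanent A (\<sigma> ` I) (\<tau> ` J)"
proof -
  have "subpermanent (\<chi> i j. A $ \<sigma> i $ \<tau> j) I J =
      subpermanent (\<chi> i j. (\<chi> i j. A $ \<sigma> i $ j) $ i $ \<tau> j) I J" by simp
  also have "\<dots> = subpermanent (\<chi> i j. A $ \<sigma> i $ j) I (\<tau> ` J)"
    by (rule subpermanent_permute_columns[OF assms(2)])
  also have "(\<chi> i j. A $ \<sigma> i $ j) = transpose (\<chi> j i. transpose A $ j $ \<sigma> i)"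
    by (simp add: transpose_def)
  also have "subpermanent \<dots> I (\<tau> ` J) = subpermanent A (\<sigma> ` I) (\<tau> ` J)"
    by (simp only: subpermanent_transpose subpermanent_permute_columns[OF assms(1)])
  finally show ?thesis .
qed

lemma subpermanent_scale:
  "subpermanent (\<chi> i j. d i * A $ i $ j * e j) I J = prod d I * subpermanent A I J * prod e J"
  unfolding subpermanent_def sum_distrib_left sum_distrib_right
proof (rule sum.cong[OF refl])
  fix f assume "f \<in> {f. f \<in> I \<rightarrow>\<^sub>E J \<and> bij_betw f I J}"
  then have "(\<Prod>i\<in>I. e (f i)) = prod e J" by (simp add: prod.reindex_bij_betw)
  then show "(\<Prod>i\<in>I. (\<chi> i j. d i * A $ i $ j * e j) $ i $ f i) = prod d I * (\<Prod>i\<in>I. A $ i $ f i) * prod e J"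
    by (simp add: prod.distrib)
qed

text \<open>Multiplication on either side by a permutation matrix and a diagonal matrix, written
  entrywise as in \<open>perm_diagonal_product\<close>.\<close>

definition monomial_equiv ::
    "('n \<Rightarrow> 'a) \<Rightarrow> ('n \<Rightarrow> 'n) \<Rightarrow> ('n \<Rightarrow> 'n) \<Rightarrow> ('n \<Rightarrow> 'a) \<Rightarrow> 'a::field ^ 'n ^ 'n \<Rightarrow> 'a ^ 'n ^ 'n" where
  "monomial_equiv d \<sigma> \<tau> e A = (\<chi> i j. d i * A $ \<sigma> i $ \<tau> j * e j)"

lemma monomial_equiv_inverse:
  assumes "bij \<sigma>" "bij \<tau>" "\<And>i. d i \<noteq> 0" "\<And>i. e i \<noteq> 0"
  shows "monomial_equiv d \<sigma> \<tau> e
    (monomial_equiv (\<lambda>i. inverse (d (inv \<sigma> i))) (inv \<sigma>) (inv \<tau>) (\<lambda>i. inverse (e (inv \<tau> i))) A) = A"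
  using assms by (simp add: monomial_equiv_def vec_eq_iff bij_is_inj)

lemma prk_monomial_equiv_le:
  assumes "inj \<sigma>" "inj \<tau>"
  shows "prk (monomial_equiv d \<sigma> \<tau> e A) \<le> prk A"
  unfolding prk_le_iff
proof (intro allI impI)
  fix I J assume IJ: "card I = card J" and "subpermanent (monomial_equiv d \<sigma> \<tau> e A) I J \<noteq> 0"
  moreover have "monomial_equiv d \<sigma> \<tau> e A = (\<chi> i j. d i * (\<chi> i j. A $ \<sigma> i $ \<tau> j) $ i $ j * e j)"
    by (simp add: monomial_equiv_def)
  ultimately have "subpermanent A (\<sigma> ` I) (\<tau> ` J) \<noteq> 0"
    by (simp only: subpermanent_scale subpermanent_permute[OF assms]) auto
  then have "card (\<sigma> ` I) \<le> prk A"
    using assms IJ by (intro prk_geI) (simp_all add: card_image inj_on_subset)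
  then show "card I \<le> prk A" using assms by (simp add: card_image inj_on_subset)
qed

text \<open>One inclusion is the rank inequality; the other applies it to the inverse, again a
  monomial equivalence.\<close>

lemma monomial_equiv_image_prk_le:
  assumes "bij \<sigma>" "bij \<tau>" "\<And>i. d i \<noteq> 0" "\<And>i. e i \<noteq> 0"
  shows "monomial_equiv d \<sigma> \<tau> e ` \<Lambda>\<^sub>\<le> k = \<Lambda>\<^sub>\<le> k"
proof
  show "monomial_equiv d \<sigma> \<tau> e ` \<Lambda>\<^sub>\<le> k \<subseteq> \<Lambda>\<^sub>\<le> k"
    using assms prk_monomial_equiv_le[of \<sigma> \<tau> d e]
    by (auto simp: prk_le_def bij_is_inj intro: order_trans)
  show "\<Lambda>\<^sub>\<le> k \<subseteq> monomial_equiv d \<sigma> \<tau> e ` \<Lambda>\<^sub>\<le> k"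
  proof
    fix A :: "'b ^ 'a ^ 'a" assume A: "A \<in> \<Lambda>\<^sub>\<le> k"
    let ?B = "monomial_equiv (\<lambda>i. inverse (d (inv \<sigma> i))) (inv \<sigma>) (inv \<tau>) (\<lambda>i. inverse (e (inv \<tau> i))) A"
    have "inj (inv \<sigma>)" "inj (inv \<tau>)"
      using assms(1,2) by (simp_all add: bij_imp_bij_inv bij_is_inj)
    then have "prk ?B \<le> prk A" by (rule prk_monomial_equiv_le)
    then have "?B \<in> \<Lambda>\<^sub>\<le> k" using A by (simp add: prk_le_def)
    moreover have "monomial_equiv d \<sigma> \<tau> e ?B = A"
      by (rule monomial_equiv_inverse) (use assms in auto)
    ultimately show "A \<in> monomial_equiv d \<sigma> \<tau> e ` \<Lambda>\<^sub>\<le> k"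
      by (auto intro: rev_image_eqI)
  qed
qed

text \<open>Row \<open>i\<close> of \<open>perm_matrix \<sigma>\<close> has its 1 in column
  \<open>inv \<sigma> i\<close>, and column \<open>j\<close> has it in row
  \<open>\<sigma> j\<close>. Hence left multiplication brings in the inverse and right
  multiplication does not.\<close>

lemma perm_diagonal_product:
  assumes "\<sigma>1 permutes UNIV" "\<sigma>2 permutes UNIV" "diagonal_matrix D1" "diagonal_matrix D2"
  shows "D1 ** perm_matrix \<sigma>1 ** A ** perm_matrix \<sigma>2 ** D2 =
    monomial_equiv (\<lambda>i. D1 $ i $ i) (inv \<sigma>1) \<sigma>2 (\<lambda>i. D2 $ i $ i) A"
proof -
  have D1: "(D1 ** B) $ i $ j = D1 $ i $ i * B $ i $ j" for B i j
  proof -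
    have "(\<Sum>l\<in>UNIV. D1 $ i $ l * B $ l $ j) = (\<Sum>l\<in>UNIV. if l = i then D1 $ i $ i * B $ i $ j else 0)"
      using assms(3) by (intro sum.cong) (auto simp: diagonal_matrix_def)
    then show ?thesis by (simp add: matrix_matrix_mult_def)
  qed
  have D2: "(B ** D2) $ i $ j = B $ i $ j * D2 $ j $ j" for B i j
  proof -
    have "(\<Sum>l\<in>UNIV. B $ i $ l * D2 $ l $ j) = (\<Sum>l\<in>UNIV. if l = j then B $ i $ j * D2 $ j $ j else 0)"
      using assms(4) by (intro sum.cong) (auto simp: diagonal_matrix_def)
    then show ?thesis by (simp add: matrix_matrix_mult_def)
  qed
  have P1: "(perm_matrix \<sigma>1 ** B) $ i $ j = B $ inv \<sigma>1 i $ j" for B i j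
    by (simp add: matrix_matrix_mult_def perm_matrix_def if_distrib[of "\<lambda>x. x * _"] cong: if_cong)
  have "j = inv \<sigma>2 l \<longleftrightarrow> l = \<sigma>2 j" for j l
    using assms(2) by (metis permutes_inv_eq)
  then have P2: "(B ** perm_matrix \<sigma>2) $ i $ j = B $ i $ \<sigma>2 j" for B i j
    by (simp add: matrix_matrix_mult_def perm_matrix_def if_distrib[of "\<lambda>x. _ * x"] cong: if_cong)
  show ?thesis
    by (simp only: vec_eq_iff D2 P2 monomial_equiv_def vec_lambda_beta)
      (simp add: matrix_mul_assoc[symmetric] D1 P1)
qed

section \<open>Preservers of permanental rank\<close>

locale prk_preserver =
  fixes T :: "'a::field ^ 'n ^ 'n \<Rightarrow> 'a ^ 'n ^ 'n" and k :: nat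
  assumes two: "(2::'a) \<noteq> 0" and n: "CARD('n) \<ge> 3" and k1: "1 \<le> k" and kn: "k < CARD('n)"
    and lin: "Vector_Spaces.linear mat_scale mat_scale T"
    and image: "T ` \<Lambda>\<^sub>\<le> k = \<Lambda>\<^sub>\<le> k"
begin

interpretation T: Vector_Spaces.linear mat_scale mat_scale T by (rule lin)

lemma mat_unit_in_prk_le: "(mat_unit p :: 'a ^ 'n ^ 'n) \<in> \<Lambda>\<^sub>\<le> k"
proof -
  have "prk (mat_unit p :: 'a ^ 'n ^ 'n) \<le> card {fst p}" by (rule prk_le_supported_rows) auto
  then show ?thesis using k1 by (simp add: prk_le_def)
qed

lemma surj: "surj T"
proof -
  have "mat.span (range mat_unit) \<subseteq> range T"
  proof (rule mat.span_minimal)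
    show "range mat_unit \<subseteq> range T" using mat_unit_in_prk_le image by blast
    show "mat.subspace (range T)"
      by (rule mat.linear_subspace_image[OF lin mat.subspace_UNIV])
  qed
  then show ?thesis by (auto simp: coord_space_eq_span[symmetric] coord_space_UNIV)
qed

lemma inj: "inj T"
  by (rule mat.linear_surj_imp_inj[OF lin surj])

lemma in_prk_le_iff: "T A \<in> \<Lambda>\<^sub>\<le> k \<longleftrightarrow> A \<in> \<Lambda>\<^sub>\<le> k"
  using image inj by (metis image_iff injD)

lemma image_coord_space:
  assumes "coord_space S \<subseteq> (\<Lambda>\<^sub>\<le> k :: ('a ^ 'n ^ 'n) set)" "card S = CARD('n) * k"
  shows "\<exists>S'. T ` coord_space S = coord_space S'"
proof (rule max_dim_subspace_is_coord_space[OF two n kn])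
  show "mat.subspace (T ` coord_space S)"
    by (rule mat.linear_subspace_image[OF lin subspace_coord_space])
  show "T ` coord_space S \<subseteq> \<Lambda>\<^sub>\<le> k" using assms(1) in_prk_le_iff by blast
  show "mat.dim (T ` coord_space S) = CARD('n) * k"
    by (subst dim_linear_image[OF lin subspace_coord_space])
      (use inj assms(2) in \<open>auto simp: dim_coord_space intro: inj_on_subset\<close>)
qed

lemma image_rows: "card I = k \<Longrightarrow> \<exists>S. T ` coord_space (I \<times> UNIV) = coord_space S"
  by (rule image_coord_space)
    (auto simp: prk_le_def coord_space_def card_cartesian_product intro!: prk_le_supported_rows)

lemma image_columns:
  assumes "card J = k"
  shows "\<exists>S. T ` coord_space (UNIV \<times> J) = coord_space S"
proof (rule image_coord_space)
  show "coord_space (UNIV \<times> J) \<subseteq> (\<Lambda>\<^sub>\<le> k :: ('a ^ 'n ^ 'n) set)"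
  proof
    fix A :: "'a ^ 'n ^ 'n" assume "A \<in> coord_space (UNIV \<times> J)"
    then have "prk (transpose A) \<le> card J"
      by (intro prk_le_supported_rows) (auto simp: coord_space_def transpose_def)
    then show "A \<in> \<Lambda>\<^sub>\<le> k" using assms by (simp add: prk_le_def)
  qed
qed (use assms in \<open>simp add: card_cartesian_product\<close>)

text \<open>
  The line spanned by a matrix unit is the intersection of the \<open>k\<close>-row and \<open>k\<close>-column spaces
  containing it, so its image is again a coordinate subspace.
\<close>

lemma image_mat_unit: "\<exists>q c. c \<noteq> 0 \<and> T (mat_unit p) = mat_scale c (mat_unit q)"
proof -
  obtain i j where p: "p = (i, j)" by (cases p)
  define F where "F = {I \<times> UNIV | I. card I = k \<and> i \<in> I} \<union> {UNIV \<times> J | J. card J = k \<and> j \<in> J}"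
  have "\<forall>S\<in>F. \<exists>S'. T ` coord_space S = coord_space S'"
    using image_rows image_columns by (auto simp: F_def)
  then obtain g where g: "\<And>S. S \<in> F \<Longrightarrow> T ` coord_space S = coord_space (g S)"
    by metis
  have sep: "\<exists>I. card I = k \<and> x \<in> I \<and> y \<notin> I" if "x \<noteq> y" for x y :: 'n
    using exists_subset_between[of "{x}" k "UNIV - {y}"] k1 kn that by fastforce
  have single: "B \<in> coord_space {p}" if B: "\<And>S. S \<in> F \<Longrightarrow> B \<in> coord_space S" for B :: "'a ^ 'n ^ 'n"
    unfolding coord_space_def
  proof (intro CollectI allI impI)
    fix i' j' assume "(i', j') \<notin> {p}"
    then consider "i \<noteq> i'" | "j \<noteq> j'" by (auto simp: p)
    then show "B $ i' $ j' = 0"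
    proof cases
      case 1
      then obtain I where "card I = k" "i \<in> I" "i' \<notin> I" using sep by blast
      then show ?thesis using B[of "I \<times> UNIV"] by (auto simp: F_def coord_space_def)
    next
      case 2
      then obtain J where "card J = k" "j \<in> J" "j' \<notin> J" using sep by blast
      then show ?thesis using B[of "UNIV \<times> J"] by (auto simp: F_def coord_space_def)
    qed
  qed
  have "(mat_unit p :: 'a ^ 'n ^ 'n) $ i $ j \<noteq> 0 $ i $ j" by (simp add: p)
  then have "T (mat_unit p) \<noteq> T 0" using injD[OF inj] by metis
  then have "T (mat_unit p) \<noteq> 0" by (simp add: T.zero)
  then obtain r s where rs: "T (mat_unit p) $ r $ s \<noteq> 0" by (auto simp: vec_eq_iff)
  \<comment> \<open>Since \<open>T (mat_unit p)\<close> is nonzero at \<open>(r, s)\<close>, every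
    \<open>coord_space (g S)\<close> contains \<open>mat_unit (r, s)\<close>. Its preimage
    \<open>B\<close> then lies in every \<open>coord_space S\<close>, so it is a multiple of
    \<open>mat_unit p\<close>.\<close>
  obtain B where B: "T B = mat_unit (r, s)" using surj by (metis surjD)
  have "B \<in> coord_space S" if S: "S \<in> F" for S
  proof -
    have "mat_unit p \<in> (coord_space S :: ('a ^ 'n ^ 'n) set)"
      using S by (auto simp: F_def coord_space_def p)
    then have "T (mat_unit p) \<in> coord_space (g S)" using g[OF S] by blast
    then have "(r, s) \<in> g S" using rs by (auto simp: coord_space_def)
    then have "mat_unit (r, s) \<in> T ` coord_space S"
      unfolding g[OF S] by (auto simp: coord_space_def)
    then show ?thesis using B inj by (metis imageE injD)
  qed
  then have "B \<in> coord_space {p}" by (rule single)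
  then have "B = mat_scale (B $ i $ j) (mat_unit p)"
    using mat_expand[of B "{p}"] by (simp add: p)
  then have *: "mat_unit (r, s) = mat_scale (B $ i $ j) (T (mat_unit p))"
    using B T.scale by metis
  from arg_cong[OF this, of "\<lambda>A. A $ r $ s"] have nz: "B $ i $ j \<noteq> 0" by auto
  have "T (mat_unit p) = mat_scale (inverse (B $ i $ j)) (mat_unit (r, s))"
    using nz unfolding * by (simp add: vec_eq_iff)
  then show ?thesis using nz by (intro exI[of _ "(r, s)"] exI[of _ "inverse (B $ i $ j)"]) simp
qed

lemma apply_expand: "T A = (\<Sum>p\<in>UNIV. mat_scale (A $ fst p $ snd p) (T (mat_unit p)))"
proof -
  have "T A = T (\<Sum>p\<in>UNIV. mat_scale (A $ fst p $ snd p) (mat_unit p))"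
    using mat_expand[of A UNIV] by (simp add: coord_space_UNIV)
  then show ?thesis by (simp add: T.sum T.scale)
qed

section \<open>The induced map on positions and its coefficients\<close>

context
  fixes \<pi> :: "'n \<times> 'n \<Rightarrow> 'n \<times> 'n" and c :: "'n \<times> 'n \<Rightarrow> 'a"
  assumes c: "\<And>p. c p \<noteq> 0" and \<pi>: "\<And>p. T (mat_unit p) = mat_scale (c p) (mat_unit (\<pi> p))"
begin

text \<open>If \<open>\<pi> p = \<pi> q\<close>, then suitable nonzero multiples of the two matrix
  units have the same image under the injective \<open>T\<close>.\<close>

lemma inj_positions: "inj \<pi>"
proof (rule injI)
  fix p q assume eq: "\<pi> p = \<pi> q"
  have "T (mat_scale (c q) (mat_unit p)) = T (mat_scale (c p) (mat_unit q))"
    using eq by (simp add: T.scale \<pi> vec_eq_iff)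
  then have "mat_scale (c q) (mat_unit p) = mat_scale (c p) (mat_unit q)" using inj by (simp add: inj_eq)
  from arg_cong[OF this, of "\<lambda>A. A $ fst p $ snd p"] show "p = q"
    using c by (auto split: if_splits)
qed

lemma apply_nth: "T A $ fst (\<pi> p) $ snd (\<pi> p) = c p * A $ fst p $ snd p"
proof -
  have "T A $ fst (\<pi> p) $ snd (\<pi> p) =
      (\<Sum>q\<in>UNIV. A $ fst q $ snd q * (c q * (if \<pi> p = \<pi> q then 1 else 0)))"
    by (subst apply_expand) (simp add: sum_mat_nth \<pi> mult.assoc)
  also have "\<dots> = (\<Sum>q\<in>UNIV. if q = p then c p * A $ fst p $ snd p else 0)"
    using inj_positions by (intro sum.cong) (auto simp: inj_eq)
  finally show ?thesis by simp
qed

text \<open>Take a partial permutation matrix \<open>B\<close> of size \<open>k + 1\<close> through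
  \<open>p\<close> and \<open>q\<close>. Its rank exceeds \<open>k\<close>, hence so does that of
  \<open>T B\<close>, which has at most \<open>k + 1\<close> nonzero entries. A nonzero permanent of
  size above \<open>k\<close> uses all of them, so they lie in distinct rows and columns.\<close>

lemma noncollinear_positions:
  assumes "fst p \<noteq> fst q" "snd p \<noteq> snd q"
  shows "fst (\<pi> p) \<noteq> fst (\<pi> q) \<and> snd (\<pi> p) \<noteq> snd (\<pi> q)"
proof -
  obtain \<rho> where \<rho>: "\<rho> permutes UNIV" "\<rho> (fst p) = snd p" "\<rho> (fst q) = snd q"
    using permutation_through_two[OF assms] .
  obtain I where I: "{fst p, fst q} \<subseteq> I" "card I = Suc k"
    using exists_subset_between[of "{fst p, fst q}" "Suc k" UNIV] assms(1) k1 kn by auto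
  let ?P = "(\<lambda>i. (i, \<rho> i)) ` I"
  define B :: "'a ^ 'n ^ 'n" where "B = (\<chi> i j. if i \<in> I \<and> j = \<rho> i then 1 else 0)"
  have inj\<rho>: "inj_on \<rho> I" using permutes_inj[OF \<rho>(1)] by (rule inj_on_subset) simp
  have "subpermanent B (I \<union> {}) (\<rho> ` I \<union> {}) = (\<Prod>i\<in>I. B $ i $ \<rho> i) * subpermanent B {} {}"
    using inj\<rho> by (intro subpermanent_monomial_rows) (auto simp: B_def)
  then have "subpermanent B I (\<rho> ` I) \<noteq> 0" by (simp add: B_def)
  then have "B \<notin> \<Lambda>\<^sub>\<le> k"
    using subpermanent_eq_0[of B k I "\<rho> ` I"] inj\<rho> I(2) by (auto simp: card_image)
  then have "\<not> prk (T B) \<le> k" using in_prk_le_iff by (simp add: prk_le_def)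
  then obtain R C where RC: "card R = card C" "subpermanent (T B) R C \<noteq> 0" "\<not> card R \<le> k"
    unfolding prk_le_iff by blast
  then obtain f where f: "bij_betw f R C" "\<And>r. r \<in> R \<Longrightarrow> T B $ r $ f r \<noteq> 0"
    using subpermanent_nonzeroE by metis
  have bij: "bij \<pi>" using inj_positions by (simp add: bij_betw_def finite_UNIV_inj_surj)
  have "(\<lambda>r. (r, f r)) ` R \<subseteq> \<pi> ` ?P"
  proof (intro image_subsetI)
    fix r assume "r \<in> R"
    obtain x where x: "\<pi> x = (r, f r)" using bij by (metis bij_pointE)
    then have "c x * B $ fst x $ snd x \<noteq> 0"
      using f(2)[OF \<open>r \<in> R\<close>] apply_nth[of B x] by simp
    then have "x \<in> ?P" by (cases x) (auto simp: B_def split: if_splits)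
    then show "(r, f r) \<in> \<pi> ` ?P" using x by (metis image_eqI)
  qed
  moreover have "card (\<pi> ` ?P) \<le> card ((\<lambda>r. (r, f r)) ` R)"
  proof -
    have "card (\<pi> ` ?P) \<le> card I" by (metis card_image_le finite le_trans)
    also have "\<dots> \<le> card R" using I(2) RC(3) by simp
    also have "\<dots> = card ((\<lambda>r. (r, f r)) ` R)" by (simp add: card_image inj_on_def)
    finally show ?thesis .
  qed
  ultimately have graph: "\<pi> ` ?P = (\<lambda>r. (r, f r)) ` R"
    by (metis card_seteq finite)
  have "p \<in> ?P" "q \<in> ?P"
    using I(1) \<rho> by (auto simp: prod_eq_iff intro!: image_eqI[of p _ "fst p"] image_eqI[of q _ "fst q"])
  then have "\<pi> p \<in> (\<lambda>r. (r, f r)) ` R" "\<pi> q \<in> (\<lambda>r. (r, f r)) ` R"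
    using graph by blast+
  moreover have "\<pi> p \<noteq> \<pi> q" using inj_positions assms(1) by (auto dest: injD)
  ultimately show ?thesis using f(1) by (auto simp: bij_betw_def dest: inj_onD)
qed

text \<open>\<open>B\<close> carries the block \<open>((1, 1), (1, -1))\<close> in rows
  \<open>i\<close>, \<open>m\<close> and columns \<open>j\<close>, \<open>l\<close>, padded with
  \<open>k - 1\<close> ones along \<open>\<rho>\<close>. It has permanent 0, so \<open>B\<close> and
  hence \<open>T B\<close> have rank at most \<open>k\<close>. In \<open>T B\<close> the
  corresponding permanent is a nonzero multiple of
  \<open>c (i, l) * c (m, j) - c (i, j) * c (m, l)\<close>.\<close>

lemma coefficients_rank_one:
  assumes \<sigma>: "inj \<sigma>" and \<tau>: "inj \<tau>" and form: "\<And>i j. \<pi> (i, j) = (\<sigma> i, \<tau> j)"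
  shows "c (i, j) * c (m, l) = c (i, l) * c (m, j)"
proof (cases "i = m \<or> j = l")
  case True
  then show ?thesis by auto
next
  case False
  then have im: "i \<noteq> m" and jl: "j \<noteq> l" by auto
  obtain \<rho> where \<rho>: "\<rho> permutes UNIV" "\<rho> i = j" "\<rho> m = l"
    using permutation_through_two[OF im jl] .
  obtain I' where I': "{i, m} \<subseteq> I'" "card I' = Suc k"
    using exists_subset_between[of "{i, m}" "Suc k" UNIV] im k1 kn by auto
  define I where "I = I' - {i, m}"
  have II: "I' = I \<union> {i, m}" "I \<inter> {i, m} = {}" using I' by (auto simp: I_def)
  have inj\<rho>: "inj \<rho>" using permutes_inj[OF \<rho>(1)] .
  have ne: "\<rho> x \<noteq> j" "\<rho> x \<noteq> l" if "x \<in> I" for x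
    using that II(2) inj\<rho> \<rho> by (metis IntI empty_iff injD insert_iff)+
  define B :: "'a ^ 'n ^ 'n" where "B = (\<chi> x y. if x \<in> I \<and> y = \<rho> x then 1
      else if x = m \<and> y = l then -1 else if x \<in> {i, m} \<and> y \<in> {j, l} then 1 else 0)"
  have perm: "subpermanent A I' (\<rho> ` I') = (\<Prod>x\<in>I. A $ x $ \<rho> x) *
      (A $ i $ j * A $ m $ l + A $ i $ l * A $ m $ j)"
    if "\<And>x y. x \<in> I \<Longrightarrow> y \<noteq> \<rho> x \<Longrightarrow> A $ x $ y = 0" for A :: "'a ^ 'n ^ 'n"
  proof -
    have "\<rho> ` I' = \<rho> ` I \<union> {j, l}" using \<rho> by (simp add: II(1))
    then have "subpermanent A I' (\<rho> ` I') = (\<Prod>x\<in>I. A $ x $ \<rho> x) * subpermanent A {i, m} {j, l}"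
      using II ne that inj_on_subset[OF inj\<rho>, of I]
      by (simp only: II(1)) (intro subpermanent_monomial_rows, auto)
    then show ?thesis using im jl by (simp add: subpermanent_doubleton)
  qed
  have row: "B $ x $ y = (if y = \<rho> x then 1 else 0)" if "x \<in> I" for x y
    using that II(2) by (auto simp: B_def)
  have block: "B $ i $ j = 1" "B $ i $ l = 1" "B $ m $ j = 1" "B $ m $ l = -1"
    using II(2) im jl by (auto simp: B_def)
  have "prk B \<le> k"
    unfolding prk_le_iff
  proof (intro allI impI, rule ccontr)
    fix R C assume RC: "card R = card C" "subpermanent B R C \<noteq> 0" "\<not> card R \<le> k"
    obtain f where f: "bij_betw f R C" "\<And>r. r \<in> R \<Longrightarrow> B $ r $ f r \<noteq> 0"
      using subpermanent_nonzeroE[OF RC(2)] by metis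
    \<comment> \<open>A nonzero term uses only the \<open>k + 1\<close> rows and columns meeting the
      support, so only one submatrix of size above \<open>k\<close> is in question.\<close>
    have "r \<in> I' \<and> f r \<in> \<rho> ` I'" if "r \<in> R" for r
      using f(2)[OF that] \<rho>(2,3) by (auto simp: B_def II(1) split: if_splits)
    then have "R \<subseteq> I'" "C \<subseteq> \<rho> ` I'" using f(1) by (auto simp: bij_betw_def)
    moreover have "card (\<rho> ` I') = Suc k" using I'(2) inj\<rho> by (simp add: card_image inj_on_subset)
    ultimately have "R = I'" "C = \<rho> ` I'" using RC I'(2) by (simp_all add: card_seteq)
    then have "subpermanent B R C = 0" using perm[of B] by (simp add: row block)
    then show False using RC(2) by contradiction
  qed
  then have TB: "T B \<in> \<Lambda>\<^sub>\<le> k" by (simp add: in_prk_le_iff) (simp add: prk_le_def)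
  \<comment> \<open>Undoing the permutations of rows and columns leaves \<open>B\<close> with its
    entries multiplied by \<open>c\<close>.\<close>
  define A :: "'a ^ 'n ^ 'n" where "A = (\<chi> x y. T B $ \<sigma> x $ \<tau> y)"
  have A: "A $ x $ y = c (x, y) * B $ x $ y" for x y
    using apply_nth[of B "(x, y)"] by (simp add: A_def form)
  have "subpermanent A I' (\<rho> ` I') = subpermanent (T B) (\<sigma> ` I') (\<tau> ` \<rho> ` I')"
    unfolding A_def by (rule subpermanent_permute[OF \<sigma> \<tau>])
  also have "\<dots> = 0"
    using I'(2) inj_on_subset[OF \<sigma>] inj_on_subset[OF \<tau>] inj_on_subset[OF inj\<rho>]
    by (intro subpermanent_eq_0[OF TB]) (simp_all add: card_image)
  finally have "(\<Prod>x\<in>I. A $ x $ \<rho> x) * (A $ i $ j * A $ m $ l + A $ i $ l * A $ m $ j) = 0"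
    using perm[of A] by (simp add: A row)
  moreover have "(\<Prod>x\<in>I. A $ x $ \<rho> x) \<noteq> 0" by (simp add: A row c)
  ultimately show ?thesis by (simp add: A block)
qed

lemma monomial_equiv_if_rows_to_rows:
  assumes \<sigma>: "inj \<sigma>" and \<tau>: "inj \<tau>" and form: "\<And>i j. \<pi> (i, j) = (\<sigma> i, \<tau> j)"
  shows "\<exists>d e. (\<forall>i. d i \<noteq> 0) \<and> (\<forall>i. e i \<noteq> 0) \<and> (\<forall>A. T A = monomial_equiv d (inv \<sigma>) (inv \<tau>) e A)"
proof -
  have surj: "surj \<sigma>" "surj \<tau>" using \<sigma> \<tau> by (simp_all add: finite_UNIV_inj_surj)
  fix a :: 'n
  \<comment> \<open>Normalisation at an arbitrary base index \<open>a\<close>: the rank one identity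
    gives \<open>c (x, y) * c (a, a) = c (x, a) * c (a, y)\<close>.\<close>
  define d where "d i = c (inv \<sigma> i, a) / c (a, a)" for i
  define e where "e j = c (a, inv \<tau> j)" for j
  have "T A $ x $ y = d x * A $ inv \<sigma> x $ inv \<tau> y * e y" for A x y
  proof -
    have "T A $ x $ y = c (inv \<sigma> x, inv \<tau> y) * A $ inv \<sigma> x $ inv \<tau> y"
      using apply_nth[of A "(inv \<sigma> x, inv \<tau> y)"] surj by (simp add: form surj_f_inv_f)
    moreover have "c (inv \<sigma> x, inv \<tau> y) = d x * e y"
      using coefficients_rank_one[OF assms, of "inv \<sigma> x" "inv \<tau> y" a a] c[of "(a, a)"]
      by (simp add: d_def e_def field_simps)
    ultimately show ?thesis by simp
  qed
  then have "\<forall>A. T A = monomial_equiv d (inv \<sigma>) (inv \<tau>) e A"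
    by (simp add: vec_eq_iff monomial_equiv_def)
  moreover have "\<forall>i. d i \<noteq> 0" "\<forall>i. e i \<noteq> 0" using c by (simp_all add: d_def e_def)
  ultimately show ?thesis by blast
qed

end

lemma image_mat_unit_positions:
  "\<exists>\<pi> c. (\<forall>p. c p \<noteq> 0) \<and> (\<forall>p. T (mat_unit p) = mat_scale (c p) (mat_unit (\<pi> p)))"
  using image_mat_unit by metis

end

section \<open>Monomial maps and the characterization of preservers\<close>

definition monomial_map :: "('a::field ^ 'n ^ 'n \<Rightarrow> 'a ^ 'n ^ 'n) \<Rightarrow> bool" where
  "monomial_map T \<longleftrightarrow> (\<exists>\<sigma> \<tau> d e. bij \<sigma> \<and> bij \<tau> \<and> (\<forall>i. d i \<noteq> 0) \<and> (\<forall>i. e i \<noteq> 0) \<and>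
     (\<forall>A. T A = monomial_equiv d \<sigma> \<tau> e A))"

lemma monomial_map_iff:
  "monomial_map T \<longleftrightarrow> (\<exists>\<sigma>1 \<sigma>2 D1 D2. \<sigma>1 permutes UNIV \<and> \<sigma>2 permutes UNIV \<and>
     diagonal_matrix D1 \<and> (\<forall>i. D1 $ i $ i \<noteq> 0) \<and> diagonal_matrix D2 \<and> (\<forall>i. D2 $ i $ i \<noteq> 0) \<and>
     (\<forall>A. T A = D1 ** perm_matrix \<sigma>1 ** A ** perm_matrix \<sigma>2 ** D2))" (is "_ \<longleftrightarrow> ?R")
proof
  assume "monomial_map T"
  then obtain \<sigma> \<tau> d e where b: "bij \<sigma>" "bij \<tau>" and nz: "\<And>i. d i \<noteq> 0" "\<And>i. e i \<noteq> 0"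
    and T: "\<And>A. T A = monomial_equiv d \<sigma> \<tau> e A"
    unfolding monomial_map_def by blast
  define D where "D f = (\<chi> i j. if i = j then f i else 0)" for f :: "'b \<Rightarrow> 'a"
  have D: "diagonal_matrix (D f)" "D f $ i $ i = f i" for f i
    by (simp_all add: D_def diagonal_matrix_def)
  have p: "inv \<sigma> permutes UNIV" "\<tau> permutes UNIV"
    using b by (auto intro!: bij_imp_permutes bij_imp_bij_inv)
  have "T A = D d ** perm_matrix (inv \<sigma>) ** A ** perm_matrix \<tau> ** D e" for A
    using perm_diagonal_product[OF p D(1)[of d] D(1)[of e]] b by (simp add: T D(2) inv_inv_eq)
  then show ?R using p D nz by metis
next
  assume ?R
  then obtain \<sigma>1 \<sigma>2 D1 D2 where p: "\<sigma>1 permutes UNIV" "\<sigma>2 permutes UNIV"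
    and D: "diagonal_matrix D1" "diagonal_matrix D2"
    and nz: "\<And>i. D1 $ i $ i \<noteq> 0" "\<And>i. D2 $ i $ i \<noteq> 0"
    and T: "\<And>A. T A = D1 ** perm_matrix \<sigma>1 ** A ** perm_matrix \<sigma>2 ** D2"
    by blast
  have "T A = monomial_equiv (\<lambda>i. D1 $ i $ i) (inv \<sigma>1) \<sigma>2 (\<lambda>i. D2 $ i $ i) A" for A
    by (simp only: T perm_diagonal_product[OF p D])
  moreover have "bij (inv \<sigma>1)" "bij \<sigma>2"
    using p by (auto intro!: permutes_bij permutes_inv)
  ultimately show "monomial_map T" 
    using nz unfolding monomial_map_def
    by (intro exI[of _ "inv \<sigma>1"] exI[of _ \<sigma>2] exI[of _ "\<lambda>i. D1 $ i $ i"] exI[of _ "\<lambda>i. D2 $ i $ i"])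
      simp
qed

lemma monomial_map_image_prk_le:
  assumes "monomial_map T"
  shows "T ` \<Lambda>\<^sub>\<le> k = \<Lambda>\<^sub>\<le> k"
proof -
  obtain \<sigma> \<tau> d e where "bij \<sigma>" "bij \<tau>" "\<And>i. d i \<noteq> 0" "\<And>i. e i \<noteq> 0"
    and T: "\<And>A. T A = monomial_equiv d \<sigma> \<tau> e A"
    using assms unfolding monomial_map_def by blast
  then show ?thesis using monomial_equiv_image_prk_le[of \<sigma> \<tau> d e k] by (simp add: image_def T)
qed

lemma transpose_image_prk_le: "transpose ` \<Lambda>\<^sub>\<le> k = (\<Lambda>\<^sub>\<le> k :: ('a::comm_ring_1 ^ 'n ^ 'n) set)"
proof -
  have "A \<in> transpose ` \<Lambda>\<^sub>\<le> k" if "A \<in> \<Lambda>\<^sub>\<le> k" for A :: "'a ^ 'n ^ 'n"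
    using that by (intro image_eqI[of _ _ "transpose A"]) simp_all
  then show ?thesis by auto
qed

lemma (in prk_preserver) monomial_map_or_transpose: "monomial_map T \<or> monomial_map (T \<circ> transpose)"
proof -
  obtain \<pi> c where c: "\<And>p. c p \<noteq> 0" and \<pi>: "\<And>p. T (mat_unit p) = mat_scale (c p) (mat_unit (\<pi> p))"
    using image_mat_unit_positions by blast
  obtain \<sigma> \<tau> where inj: "inj \<sigma>" "inj \<tau>"
    and form: "(\<forall>i j. \<pi> (i, j) = (\<sigma> i, \<tau> j)) \<or> (\<forall>i j. \<pi> (i, j) = (\<tau> j, \<sigma> i))"
    using rook_automorphism[OF _ inj_positions[OF c \<pi>] noncollinear_positions[OF c \<pi>]] n by auto
  have bij: "bij (inv \<sigma>)" "bij (inv \<tau>)"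
    using inj by (auto intro!: bij_imp_bij_inv bijI simp: finite_UNIV_inj_surj)
  from form show ?thesis
  proof
    assume "\<forall>i j. \<pi> (i, j) = (\<sigma> i, \<tau> j)"
    then have "\<exists>d e. (\<forall>i. d i \<noteq> 0) \<and> (\<forall>i. e i \<noteq> 0) \<and> (\<forall>A. T A = monomial_equiv d (inv \<sigma>) (inv \<tau>) e A)"
      using monomial_equiv_if_rows_to_rows[OF c \<pi> inj] by blast
    then show ?thesis using bij unfolding monomial_map_def by blast
  next
    assume sw: "\<forall>i j. \<pi> (i, j) = (\<tau> j, \<sigma> i)"
    \<comment> \<open>Precomposing with transposition turns the position map into
      \<open>\<pi> \<circ> prod.swap\<close>, which sends \<open>(i, j)\<close> to
      \<open>(\<tau> i, \<sigma> j)\<close> and so keeps rows as rows.\<close>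
    interpret T': prk_preserver "T \<circ> transpose" k
    proof (rule prk_preserver.intro)
      show "(T \<circ> transpose) ` \<Lambda>\<^sub>\<le> k = \<Lambda>\<^sub>\<le> k"
        by (simp only: image_comp[symmetric] transpose_image_prk_le image)
      show "Vector_Spaces.linear mat_scale mat_scale (T \<circ> transpose)"
        by (rule Vector_Spaces.linear_compose[OF linear_transpose lin])
    qed (use two n k1 kn in auto)
    have tr: "transpose (mat_unit p) = mat_unit (prod.swap p)" for p
      by (cases p) (auto simp: vec_eq_iff transpose_def)
    have "\<exists>d e. (\<forall>i. d i \<noteq> 0) \<and> (\<forall>i. e i \<noteq> 0) \<and>
        (\<forall>A. (T \<circ> transpose) A = monomial_equiv d (inv \<tau>) (inv \<sigma>) e A)"
      using sw
      by (intro T'.monomial_equiv_if_rows_to_rows[where \<pi> = "\<pi> \<circ> prod.swap" and c = "c \<circ> prod.swap"])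
        (auto simp: c \<pi> tr inj)
    then show ?thesis using bij unfolding monomial_map_def by blast
  qed
qed

theorem theorem1p3:
  fixes T :: "'a::field ^ 'n ^ 'n \<Rightarrow> 'a ^ 'n ^ 'n" and k :: nat
  assumes "CHAR('a) \<noteq> 2"
    and "CARD('n) \<ge> 3"
    and "1 \<le> k" and "k \<le> CARD('n) - 1"
    and "Vector_Spaces.linear mat_scale mat_scale T"
  shows "T ` \<Lambda>\<^sub>\<le> k = \<Lambda>\<^sub>\<le> k \<longleftrightarrow>
    (\<exists>\<sigma>\<^sub>1 \<sigma>\<^sub>2 D\<^sub>1 D\<^sub>2.
       \<sigma>\<^sub>1 permutes (UNIV :: 'n set) \<and> \<sigma>\<^sub>2 permutes (UNIV :: 'n set) \<and>
       diagonal_matrix D\<^sub>1 \<and> (\<forall>i. D\<^sub>1 $ i $ i \<noteq> 0) \<and>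
       diagonal_matrix D\<^sub>2 \<and> (\<forall>i. D\<^sub>2 $ i $ i \<noteq> 0) \<and>
       ((\<forall>A. T A = D\<^sub>1 ** perm_matrix \<sigma>\<^sub>1 ** A ** perm_matrix \<sigma>\<^sub>2 ** D\<^sub>2) \<or>
        (\<forall>A. T A = D\<^sub>1 ** perm_matrix \<sigma>\<^sub>1 ** transpose A ** perm_matrix \<sigma>\<^sub>2 ** D\<^sub>2)))"
    (is "_ \<longleftrightarrow> ?R")
proof -
  \<comment> \<open>The transposed form for \<open>T\<close> is the plain form for
    \<open>T \<circ> transpose\<close>, since transposition is an involution.\<close>
  have "(\<forall>A. T A = D1 ** P1 ** transpose A ** P2 ** D2) \<longleftrightarrow>
      (\<forall>A. (T \<circ> transpose) A = D1 ** P1 ** A ** P2 ** D2)" for D1 P1 P2 D2 :: "'a ^ 'n ^ 'n"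
    by (metis comp_apply transpose_transpose)
  then have R: "?R \<longleftrightarrow> monomial_map T \<or> monomial_map (T \<circ> transpose)"
    by (simp only: monomial_map_iff conj_disj_distribL ex_disj_distrib)
  show ?thesis
  proof
    assume image: "T ` \<Lambda>\<^sub>\<le> k = \<Lambda>\<^sub>\<le> k"
    \<comment> \<open>Otherwise the characteristic would be a positive divisor of 2 other than 1 and
      2.\<close>
    have "(2::'a) \<noteq> 0"
    proof
      assume "(2::'a) = 0"
      then have "CHAR('a) dvd 2" using of_nat_eq_0_iff_char_dvd[of 2, where 'a = 'a] by simp
      then have "CHAR('a) \<le> 2" by (rule dvd_imp_le) simp
      moreover have "CHAR('a) \<noteq> 0" using \<open>CHAR('a) dvd 2\<close> by (intro notI) simp
      ultimately show False using assms(1) CHAR_not_1'[where 'a = 'a] by linarith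
    qed
    then interpret prk_preserver T k
      using assms image by (intro prk_preserver.intro) auto
    show ?R unfolding R by (rule monomial_map_or_transpose)
  next
    assume ?R
    then consider "monomial_map T" | "monomial_map (T \<circ> transpose)" unfolding R by blast
    then show "T ` \<Lambda>\<^sub>\<le> k = \<Lambda>\<^sub>\<le> k"
    proof cases
      case 2
      have "T ` \<Lambda>\<^sub>\<le> k = T ` transpose ` \<Lambda>\<^sub>\<le> k" by (simp only: transpose_image_prk_le)
      also have "\<dots> = \<Lambda>\<^sub>\<le> k" using monomial_map_image_prk_le[OF 2] by (simp add: image_comp)
      finally show ?thesis .
    qed (rule monomial_map_image_prk_le)
  qed
qed

end
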